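(* There is an algorithm which, given a basic formula $\alpha$ whose variables are among $v_0,\dots,v_n$, either turns $\alpha$ into an equivalent (in the structure $\mathcal T$ of trees) basic formula that is solved with respect to the variable ordering $v_0<\cdots<v_n$, or returns $\mathrm{false}$ if no such solved formula exists.
   Context: Signature $(S,F,P)$: sorts $S$, generators $g: s_1\times\cdots\times s_n\to s$ (with $F_s$ the nonempty set of generators of $s$; every sort is assumed to have at least two generators), predicates $\mathrm{fin}_s$. The structure $\mathcal T$ of trees interprets each sort $s$ as the set of (possibly infinite) rooted ordered generator-labeled trees of sort $s$ (root labeled by some $g: s_1\times\cdots\times s_n\to s$, children in order trees of sorts $s_1,\dots,s_n$), each generator as tree-building, and $\mathrm{fin}_s$ as the set of finite trees of sort $s$. A basic formula is a conjunction $(\bigwedge_i v_i = t_i)\wedge(\bigwedge_j \mathrm{fin}(u_j))$ where $u_j,v_i$ are variables and each $t_i$ is a variable or a term $g(\bar z)$ with $g$ a generator and $\bar z$ variables. Given a total order on its variables, it is solved if (1) the variables $v_1,\dots,u_1,\dots$ (left-hand sides of equations and arguments of $\mathrm{fin}$) are pairwise distinct and for each equation $x=y$ between variables we have $x>y$, and (2) whenever $\mathrm{fin}(v)$ occurs, the sort of $v$ contains both finite and infinite trees.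
   Formalization: Sorts and generators are assumed to be injectively numbered by naturals, with it decidable whether a sort contains finite and whether it contains infinite trees; this is automatic for finitely many sorts and necessary in general, since the algorithm's answers on fin(v_0) decide it. *)

theory Defs
  imports Main "HOL-Library.Nat_Bijection"
begin

section \<open>Signatures and the structure of trees\<close>

text \<open>
  A generator \<open>g\<close> has type \<open>s\<^sub>1 \<times> \<dots> \<times> s\<^sub>n \<rightarrow> s\<close> with \<open>[s\<^sub>1, \<dots>, s\<^sub>n] = args \<Sigma> g\<close> and
  \<open>s = res \<Sigma> g\<close>.  The predicate symbols are exactly one \<open>fin\<^sub>s\<close> for every sort \<open>s\<close>, so they are
  not recorded.
\<close>

record ('s, 'g) signature =
  sorts :: "'s set"
  gens :: "'g set"
  args :: "'g \<Rightarrow> 's list"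
  res :: "'g \<Rightarrow> 's"

definition wf_signature :: "('s, 'g) signature \<Rightarrow> bool" where
  "wf_signature \<Sigma> \<longleftrightarrow>
     (\<forall>g\<in>gens \<Sigma>. set (args \<Sigma> g) \<subseteq> sorts \<Sigma> \<and> res \<Sigma> g \<in> sorts \<Sigma>) \<and>
     (\<forall>s\<in>sorts \<Sigma>. \<exists>g\<in>gens \<Sigma>. \<exists>h\<in>gens \<Sigma>. g \<noteq> h \<and> res \<Sigma> g = s \<and> res \<Sigma> h = s)"

codatatype 'g tree = Node (label: 'g) (children: "'g tree list")

coinductive tree_of_sort :: "('s, 'g) signature \<Rightarrow> 's \<Rightarrow> 'g tree \<Rightarrow> bool"
  for \<Sigma> :: "('s, 'g) signature" where
  "g \<in> gens \<Sigma> \<Longrightarrow> list_all2 (tree_of_sort \<Sigma>) (args \<Sigma> g) ts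
    \<Longrightarrow> tree_of_sort \<Sigma> (res \<Sigma> g) (Node g ts)"

text \<open>The nodes of a tree are represented by their positions, i.e. by paths from the root.\<close>

primrec is_position :: "nat list \<Rightarrow> 'g tree \<Rightarrow> bool" where
  "is_position [] t \<longleftrightarrow> True"
| "is_position (i # p) t \<longleftrightarrow> i < length (children t) \<and> is_position p (children t ! i)"

definition finite_tree :: "'g tree \<Rightarrow> bool" where
  "finite_tree t \<longleftrightarrow> finite {p. is_position p t}"

definition has_finite_tree :: "('s, 'g) signature \<Rightarrow> 's \<Rightarrow> bool" where
  "has_finite_tree \<Sigma> s \<longleftrightarrow> (\<exists>t. tree_of_sort \<Sigma> s t \<and> finite_tree t)"

definition has_infinite_tree :: "('s, 'g) signature \<Rightarrow> 's \<Rightarrow> bool" where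
  "has_infinite_tree \<Sigma> s \<longleftrightarrow> (\<exists>t. tree_of_sort \<Sigma> s t \<and> \<not> finite_tree t)"


section \<open>Basic formulas\<close>

text \<open>
  The variable \<open>v\<^sub>i\<close> is represented by its index \<open>i\<close>, and a list \<open>\<sigma>\<close> of length \<open>n + 1\<close> gives the
  sorts of \<open>v\<^sub>0, \<dots>, v\<^sub>n\<close>.  The pair \<open>(eqs, fins)\<close> stands for the conjunction of the equations in
  \<open>eqs\<close> and of the formulas \<open>fin(u)\<close> for \<open>u\<close> in \<open>fins\<close>.
\<close>

datatype 'g rhs = Var nat | App 'g "nat list"

type_synonym 'g basic = "(nat \<times> 'g rhs) list \<times> nat list"

definition basic_formula :: "('s, 'g) signature \<Rightarrow> 's list \<Rightarrow> 'g basic \<Rightarrow> bool" where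
  "basic_formula \<Sigma> \<sigma> \<alpha> \<longleftrightarrow>
     (\<forall>(v, t)\<in>set (fst \<alpha>). v < length \<sigma> \<and>
        (case t of
           Var y \<Rightarrow> y < length \<sigma> \<and> \<sigma> ! y = \<sigma> ! v
         | App g zs \<Rightarrow> g \<in> gens \<Sigma> \<and> res \<Sigma> g = \<sigma> ! v \<and>
             (\<forall>z\<in>set zs. z < length \<sigma>) \<and> map (\<lambda>z. \<sigma> ! z) zs = args \<Sigma> g)) \<and>
     (\<forall>u\<in>set (snd \<alpha>). u < length \<sigma>)"

definition assignment :: "('s, 'g) signature \<Rightarrow> 's list \<Rightarrow> (nat \<Rightarrow> 'g tree) \<Rightarrow> bool" where
  "assignment \<Sigma> \<sigma> \<rho> \<longleftrightarrow> (\<forall>i<length \<sigma>. tree_of_sort \<Sigma> (\<sigma> ! i) (\<rho> i))"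

primrec eval_rhs :: "(nat \<Rightarrow> 'g tree) \<Rightarrow> 'g rhs \<Rightarrow> 'g tree" where
  "eval_rhs \<rho> (Var y) = \<rho> y"
| "eval_rhs \<rho> (App g zs) = Node g (map \<rho> zs)"

definition satisfies :: "(nat \<Rightarrow> 'g tree) \<Rightarrow> 'g basic \<Rightarrow> bool" where
  "satisfies \<rho> \<alpha> \<longleftrightarrow>
     (\<forall>(v, t)\<in>set (fst \<alpha>). \<rho> v = eval_rhs \<rho> t) \<and> (\<forall>u\<in>set (snd \<alpha>). finite_tree (\<rho> u))"

definition equivalent :: "('s, 'g) signature \<Rightarrow> 's list \<Rightarrow> 'g basic \<Rightarrow> 'g basic \<Rightarrow> bool" where
  "equivalent \<Sigma> \<sigma> \<alpha> \<beta> \<longleftrightarrow>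
     (\<forall>\<rho>. assignment \<Sigma> \<sigma> \<rho> \<longrightarrow> satisfies \<rho> \<alpha> = satisfies \<rho> \<beta>)"

text \<open>Solvedness with respect to the ordering \<open>v\<^sub>0 < \<dots> < v\<^sub>n\<close>.\<close>

definition solved :: "('s, 'g) signature \<Rightarrow> 's list \<Rightarrow> 'g basic \<Rightarrow> bool" where
  "solved \<Sigma> \<sigma> \<alpha> \<longleftrightarrow>
     distinct (map fst (fst \<alpha>) @ snd \<alpha>) \<and>
     (\<forall>x y. (x, Var y) \<in> set (fst \<alpha>) \<longrightarrow> x > y) \<and>
     (\<forall>v\<in>set (snd \<alpha>). has_finite_tree \<Sigma> (\<sigma> ! v) \<and> has_infinite_tree \<Sigma> (\<sigma> ! v))"


section \<open>Algorithms\<close>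

text \<open>
  The (total) general recursive functions: \<open>recfn k f\<close> says that \<open>f\<close>, restricted to argument lists
  of length \<open>k\<close>, is general recursive.  Minimisation is restricted to regular functions, so that
  every function of the class is total.
\<close>

inductive recfn :: "nat \<Rightarrow> (nat list \<Rightarrow> nat) \<Rightarrow> bool" where
  zero: "recfn k (\<lambda>xs. 0)"
| succ: "recfn 1 (\<lambda>xs. Suc (xs ! 0))"
| proj: "i < k \<Longrightarrow> recfn k (\<lambda>xs. xs ! i)"
| comp: "recfn (length gs) f \<Longrightarrow> \<forall>g\<in>set gs. recfn k g
    \<Longrightarrow> recfn k (\<lambda>xs. f (map (\<lambda>g. g xs) gs))"
| prim_rec: "recfn k f \<Longrightarrow> recfn (Suc (Suc k)) g
    \<Longrightarrow> recfn (Suc k) (\<lambda>xs. rec_nat (f (tl xs)) (\<lambda>m r. g (m # r # tl xs)) (hd xs))"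
| mu: "recfn (Suc k) f \<Longrightarrow> \<forall>xs. length xs = k \<longrightarrow> (\<exists>y. f (y # xs) = 0)
    \<Longrightarrow> recfn k (\<lambda>xs. LEAST y. f (y # xs) = 0)"

definition recursive :: "(nat \<Rightarrow> nat) \<Rightarrow> bool" where
  "recursive A \<longleftrightarrow> (\<exists>f. recfn 1 f \<and> (\<forall>x. f [x] = A x))"

text \<open>
  Codes of formulas, given a numbering \<open>gc\<close> of the generators.  An input of the algorithm consists
  of the sorts of \<open>v\<^sub>0, \<dots>, v\<^sub>n\<close> (numbered by \<open>sc\<close>) and a formula.  The output \<open>0\<close> stands for
  \<open>false\<close>, the output \<open>c + 1\<close> for the formula with code \<open>c\<close>.
\<close>

primrec rhs_code :: "('g \<Rightarrow> nat) \<Rightarrow> 'g rhs \<Rightarrow> nat" where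
  "rhs_code gc (Var y) = sum_encode (Inl y)"
| "rhs_code gc (App g zs) = sum_encode (Inr (prod_encode (gc g, list_encode zs)))"

definition basic_code :: "('g \<Rightarrow> nat) \<Rightarrow> 'g basic \<Rightarrow> nat" where
  "basic_code gc \<alpha> = prod_encode
     (list_encode (map (\<lambda>(v, t). prod_encode (v, rhs_code gc t)) (fst \<alpha>)), list_encode (snd \<alpha>))"

definition input_code :: "('s \<Rightarrow> nat) \<Rightarrow> ('g \<Rightarrow> nat) \<Rightarrow> 's list \<Rightarrow> 'g basic \<Rightarrow> nat" where
  "input_code sc gc \<sigma> \<alpha> = prod_encode (list_encode (map sc \<sigma>), basic_code gc \<alpha>)"

definition output_code :: "('g \<Rightarrow> nat) \<Rightarrow> 'g basic option \<Rightarrow> nat" where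
  "output_code gc r = (case r of None \<Rightarrow> 0 | Some \<beta> \<Rightarrow> Suc (basic_code gc \<beta>))"

definition decidable_on :: "'s set \<Rightarrow> ('s \<Rightarrow> nat) \<Rightarrow> ('s \<Rightarrow> bool) \<Rightarrow> bool" where
  "decidable_on S sc Q \<longleftrightarrow> (\<exists>d. recursive d \<and> (\<forall>s\<in>S. d (sc s) = (if Q s then 1 else 0)))"

text \<open>
  Symbols are presented by injective numberings, and it is decidable whether a sort contains finite
  trees and whether it contains infinite trees.  The decidability is automatic for finitely many
  sorts, see \<open>effective_if_finite_sorts\<close> below.  For infinitely many sorts an algorithm cannot exist
  without it: its answers on the one-atom formulas \<open>fin(v\<^sub>0)\<close> tell which of the two kinds of trees
  the sort of \<open>v\<^sub>0\<close> contains.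
\<close>

definition effective :: "('s, 'g) signature \<Rightarrow> ('s \<Rightarrow> nat) \<Rightarrow> ('g \<Rightarrow> nat) \<Rightarrow> bool" where
  "effective \<Sigma> sc gc \<longleftrightarrow>
     inj_on sc (sorts \<Sigma>) \<and> inj_on gc (gens \<Sigma>) \<and>
     decidable_on (sorts \<Sigma>) sc (has_finite_tree \<Sigma>) \<and>
     decidable_on (sorts \<Sigma>) sc (has_infinite_tree \<Sigma>)"

lemma recfn_const: "recfn k (\<lambda>xs. c)"
proof (induction c)
  case 0
  show ?case by (rule recfn.zero)
next
  case (Suc c)
  have "recfn k (\<lambda>xs. (\<lambda>xs. Suc (xs ! 0)) (map (\<lambda>g. g xs) [\<lambda>xs. c]))"
    by (rule recfn.comp) (use Suc recfn.succ in auto)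
  then show ?case by simp
qed

lemma recursive_finite_support:
  assumes "\<forall>x\<ge>N. F x = 0"
  shows "recursive F"
  using assms
proof (induction N arbitrary: F)
  case 0
  then have "F = (\<lambda>x. 0)" by auto
  then show ?case
    unfolding recursive_def using recfn.zero[of 1] by auto
next
  case (Suc N)
  have "recursive (\<lambda>x. F (Suc x))"
    by (rule Suc.IH) (use Suc.prems in auto)
  then obtain f where f: "recfn 1 f" "\<And>x. f [x] = F (Suc x)"
    unfolding recursive_def by auto
  have "recfn 2 (\<lambda>xs. f (map (\<lambda>g. g xs) [\<lambda>xs. xs ! 0]))"
    by (rule recfn.comp) (use f recfn.proj[of 0 2] in auto)
  then have "recfn (Suc 0) (\<lambda>xs. rec_nat ((\<lambda>xs. F 0) (tl xs))
      (\<lambda>m r. (\<lambda>xs. f (map (\<lambda>g. g xs) [\<lambda>xs. xs ! 0])) (m # r # tl xs)) (hd xs))"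
    by (intro recfn.prim_rec recfn_const) (simp add: numeral_2_eq_2)
  moreover have "rec_nat (F 0) (\<lambda>m r. F (Suc m)) x = F x" for x
    by (cases x) auto
  ultimately show ?case
    unfolding recursive_def using f(2) by (intro exI conjI allI) auto
qed

lemma effective_if_finite_sorts:
  assumes "finite (sorts \<Sigma>)" "inj_on sc (sorts \<Sigma>)" "inj_on gc (gens \<Sigma>)"
  shows "effective \<Sigma> sc gc"
proof -
  have "decidable_on (sorts \<Sigma>) sc Q" for Q
  proof -
    let ?A = "sc ` {s \<in> sorts \<Sigma>. Q s}"
    obtain N where "\<forall>x\<in>?A. x < N"
      using assms(1) finite_nat_set_iff_bounded[of ?A] by auto
    then have "recursive (\<lambda>x. if x \<in> ?A then 1 else 0)"
      by (intro recursive_finite_support[of N]) auto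
    moreover have "sc s \<in> ?A \<longleftrightarrow> Q s" if "s \<in> sorts \<Sigma>" for s
      using assms(2) that by (auto simp: inj_on_def)
    ultimately show ?thesis
      unfolding decidable_on_def by (intro exI[of _ "\<lambda>x. if x \<in> ?A then 1 else 0"]) simp
  qed
  then show ?thesis using assms by (simp add: effective_def)
qed

end

theory Submission
  imports Defs
begin

text \<open>
  Let \<open>\<sim>\<close> be the congruence closure of the equations: the least equivalence relation on the variables
  that contains \<open>v \<sim> y\<close> for every equation \<open>v = y\<close> and relates the arguments of two equations
  \<open>v = g(z\<^sub>1, \<dots>)\<close>, \<open>w = g(z'\<^sub>1, \<dots>)\<close> with \<open>v \<sim> w\<close>.  The formula is unsatisfiable if some class carries
  two different generators, or if some \<open>fin(u)\<close> fails: unfolding \<open>u\<close> along the equations must stop, and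
  only at classes without generator whose sort contains a finite tree.  Otherwise mapping every
  variable to the least element of its class, keeping one equation \<open>v = g(\<dots>)\<close> per class, and
  pushing \<open>fin\<close> down to the classes without generator yields an equivalent solved formula.  Solved
  formulas are satisfiable, since the variables that are not left-hand sides can be chosen freely
  and determine the others by corecursion; hence an unsatisfiable formula has no solved form.

  All three closures are least fixed points on subsets of an initial segment of the naturals, so
  they are decidable by a bounded quantification over all such subsets, coded by bit sets.
\<close>

section \<open>Recursive functions and decidable predicates\<close>

text \<open>
  \<^const>\<open>recfn\<close> constrains the values of a function on lists of every length; only those on lists
  of length \<open>k\<close> matter, and disregarding the others allows rewriting.
\<close>

definition rf :: "nat \<Rightarrow> (nat list \<Rightarrow> nat) \<Rightarrow> bool" where
  "rf k f \<longleftrightarrow> (\<exists>f'. recfn k f' \<and> (\<forall>xs. length xs = k \<longrightarrow> f' xs = f xs))"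

lemma rf_cong: "rf k f \<Longrightarrow> (\<And>xs. length xs = k \<Longrightarrow> f xs = g xs) \<Longrightarrow> rf k g"
  unfolding rf_def by metis

lemma rf_recfn: "recfn k f \<Longrightarrow> rf k f"
  unfolding rf_def by auto

lemma rf_proj: "i < k \<Longrightarrow> rf k (\<lambda>xs. xs ! i)"
  by (intro rf_recfn recfn.proj)

lemma rf_const: "rf k (\<lambda>xs. c)"
  by (intro rf_recfn recfn_const)

lemma rf_comp:
  assumes "rf (length gs) f" "\<And>g. g \<in> set gs \<Longrightarrow> rf k g"
  shows "rf k (\<lambda>xs. f (map (\<lambda>g. g xs) gs))"
proof -
  obtain f' where f': "recfn (length gs) f'" "\<And>xs. length xs = length gs \<Longrightarrow> f' xs = f xs"
    using assms(1) unfolding rf_def by auto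
  have "\<forall>g\<in>set gs. \<exists>g'. recfn k g' \<and> (\<forall>xs. length xs = k \<longrightarrow> g' xs = g xs)"
    using assms(2) unfolding rf_def by auto
  then obtain c where c: "\<And>g. g \<in> set gs \<Longrightarrow> recfn k (c g) \<and> (\<forall>xs. length xs = k \<longrightarrow> c g xs = g xs)"
    by metis
  have "recfn k (\<lambda>xs. f' (map (\<lambda>g. g xs) (map c gs)))"
    by (rule recfn.comp) (use f' c in auto)
  moreover have "f' (map (\<lambda>g. g xs) (map c gs)) = f (map (\<lambda>g. g xs) gs)" if "length xs = k" for xs
    using that f'(2)[of "map (\<lambda>g. g xs) gs"] c by (simp add: comp_def cong: map_cong)
  ultimately show ?thesis unfolding rf_def by blast
qed

lemma rf_comp1:
  assumes "rf 1 (\<lambda>xs. h (xs ! 0))" "rf k f"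
  shows "rf k (\<lambda>xs. h (f xs))"
  using rf_comp[of "[f]" "\<lambda>xs. h (xs ! 0)" k] assms by simp

lemma rf_comp2:
  assumes "rf 2 (\<lambda>xs. h (xs ! 0) (xs ! 1))" "rf k f" "rf k g"
  shows "rf k (\<lambda>xs. h (f xs) (g xs))"
  using rf_comp[of "[f, g]" "\<lambda>xs. h (xs ! 0) (xs ! 1)" k] assms by (auto simp: numeral_2_eq_2)

lemma rf_Suc: "rf k f \<Longrightarrow> rf k (\<lambda>xs. Suc (f xs))"
  by (rule rf_comp1[of Suc]) (simp_all only: rf_recfn recfn.succ)

lemma rf_rec_nat:
  assumes "rf k f" "rf (Suc (Suc k)) g"
  shows "rf (Suc k) (\<lambda>xs. rec_nat (f (tl xs)) (\<lambda>m r. g (m # r # tl xs)) (hd xs))"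
proof -
  obtain f' where f': "recfn k f'" "\<And>xs. length xs = k \<Longrightarrow> f' xs = f xs"
    using assms(1) unfolding rf_def by auto
  obtain g' where g': "recfn (Suc (Suc k)) g'" "\<And>xs. length xs = Suc (Suc k) \<Longrightarrow> g' xs = g xs"
    using assms(2) unfolding rf_def by auto
  show ?thesis unfolding rf_def
    by (intro exI conjI, rule recfn.prim_rec[OF f'(1) g'(1)]) (simp add: f'(2) g'(2))
qed

lemma rf_Least:
  assumes "rf (Suc k) f" "\<And>xs. length xs = k \<Longrightarrow> \<exists>y. f (y # xs) = 0"
  shows "rf k (\<lambda>xs. LEAST y. f (y # xs) = 0)"
proof -
  obtain f' where f': "recfn (Suc k) f'" "\<And>xs. length xs = Suc k \<Longrightarrow> f' xs = f xs"
    using assms(1) unfolding rf_def by auto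
  show ?thesis unfolding rf_def
    by (intro exI conjI, rule recfn.mu[OF f'(1)]) (use assms(2) in \<open>simp_all add: f'(2)\<close>)
qed

lemma length_2E:
  assumes "length xs = 2" obtains x y where "xs = [x, y]"
  using assms by (auto simp: numeral_2_eq_2 length_Suc_conv)

section \<open>Arithmetic by primitive recursion\<close>

lemma rf_add: "rf 2 (\<lambda>xs. xs ! 0 + xs ! 1)"
proof -
  have "rf (Suc 1) (\<lambda>xs. rec_nat ((\<lambda>xs. xs ! 0) (tl xs)) (\<lambda>m r. (\<lambda>xs. Suc (xs ! 1)) (m # r # tl xs)) (hd xs))"
    by (intro rf_rec_nat rf_Suc rf_proj) auto
  then have "rf 2 (\<lambda>xs. rec_nat (tl xs ! 0) (\<lambda>m r. Suc r) (hd xs))"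
    by (simp add: numeral_2_eq_2)
  moreover have "rec_nat b (\<lambda>m r. Suc r) a = a + b" for a b :: nat
    by (induction a) auto
  ultimately show ?thesis
    by (elim rf_cong) (auto elim!: length_2E)
qed

lemma rf_pred: "rf 1 (\<lambda>xs. xs ! 0 - 1)"
proof -
  have "rf (Suc 0) (\<lambda>xs. rec_nat ((\<lambda>xs. 0) (tl xs)) (\<lambda>m r. (\<lambda>xs. xs ! 0) (m # r # tl xs)) (hd xs))"
    by (intro rf_rec_nat rf_const rf_proj) auto
  moreover have "rec_nat 0 (\<lambda>m r. m) a = a - 1" for a :: nat
    by (cases a) auto
  ultimately show ?thesis
    unfolding One_nat_def by (elim rf_cong) (auto simp: length_Suc_conv)
qed

lemma rf_diff: "rf 2 (\<lambda>xs. xs ! 0 - xs ! 1)"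
proof -
  have "rf (Suc 1) (\<lambda>xs. rec_nat ((\<lambda>xs. xs ! 0) (tl xs)) (\<lambda>m r. (\<lambda>xs. xs ! 1 - 1) (m # r # tl xs)) (hd xs))"
    by (intro rf_rec_nat rf_comp1[OF rf_pred] rf_proj) auto
  then have "rf 2 (\<lambda>xs. rec_nat (tl xs ! 0) (\<lambda>m r. r - 1) (hd xs))"
    by (simp add: numeral_2_eq_2)
  moreover have "rec_nat b (\<lambda>m r. r - 1) a = b - a" for a b :: nat
    by (induction a) auto
  \<comment> \<open>The recursion runs on the first entry, here the subtrahend, so the arguments
    come out in reversed order and are swapped by a composition.\<close>
  ultimately have "rf 2 (\<lambda>xs. xs ! 1 - xs ! 0)"
    by (elim rf_cong) (auto elim!: length_2E)
  from rf_comp2[OF this, of 2 "\<lambda>xs. xs ! 1" "\<lambda>xs. xs ! 0"] show ?thesis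
    by (simp add: rf_proj)
qed

lemma rf_triangle: "rf 1 (\<lambda>xs. triangle (xs ! 0))"
proof -
  have "rf (Suc 0) (\<lambda>xs. rec_nat ((\<lambda>xs. 0) (tl xs)) (\<lambda>m r. (\<lambda>xs. xs ! 1 + Suc (xs ! 0)) (m # r # tl xs)) (hd xs))"
    by (intro rf_rec_nat rf_const rf_comp2[OF rf_add] rf_Suc rf_proj) auto
  moreover have "rec_nat 0 (\<lambda>m r. r + Suc m) a = triangle a" for a :: nat
    by (induction a) auto
  ultimately show ?thesis
    unfolding One_nat_def by (elim rf_cong) (auto simp: length_Suc_conv)
qed

section \<open>The Cantor pairing and its projections\<close>

definition pair :: "nat \<Rightarrow> nat \<Rightarrow> nat" where "pair a b = prod_encode (a, b)"
definition pfst :: "nat \<Rightarrow> nat" where "pfst z = fst (prod_decode z)"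
definition psnd :: "nat \<Rightarrow> nat" where "psnd z = snd (prod_decode z)"

lemma pfst_pair [simp]: "pfst (pair a b) = a"
  and psnd_pair [simp]: "psnd (pair a b) = b"
  and pair_pfst_psnd [simp]: "pair (pfst z) (psnd z) = z"
  and pair_inject [simp]: "pair a b = pair c d \<longleftrightarrow> a = c \<and> b = d"
  by (auto simp: pair_def pfst_def psnd_def)

lemma triangle_mono: "a \<le> b \<Longrightarrow> triangle a \<le> triangle b"
  by (induction b) (auto simp: le_Suc_eq)

lemma pair_mono: "a \<le> c \<Longrightarrow> b \<le> d \<Longrightarrow> pair a b \<le> pair c d"
  unfolding pair_def prod_encode_def using triangle_mono[of "a + b" "c + d"] by simp

text \<open>The diagonal \<open>s\<close> of \<open>z\<close>, the sum of its components, satisfies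
  \<open>triangle s \<le> z < triangle (Suc s)\<close>. Truncated subtraction turns the upper bound
  into an equation with 0, and the lower bound shows that no smaller \<open>s\<close> solves
  it.\<close>

lemma pfst_plus_psnd: "pfst z + psnd z = (LEAST s. Suc z - triangle (Suc s) = 0)"
proof -
  have z: "z = triangle (pfst z + psnd z) + pfst z"
    using pair_pfst_psnd[of z] unfolding pair_def prod_encode_def by simp
  show ?thesis
  proof (rule Least_equality[symmetric])
    show "Suc z - triangle (Suc (pfst z + psnd z)) = 0" by (subst z) simp
  next
    fix s assume s: "Suc z - triangle (Suc s) = 0"
    show "pfst z + psnd z \<le> s"
    proof (rule ccontr)
      assume "\<not> ?thesis"
      then have "triangle (Suc s) \<le> z" using triangle_mono[of "Suc s" "pfst z + psnd z"] z by simp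
      then show False using s by simp
    qed
  qed
qed

lemma rf_pfst_plus_psnd: "rf 1 (\<lambda>xs. pfst (xs ! 0) + psnd (xs ! 0))"
proof -
  have "rf 1 (\<lambda>xs. LEAST y. (\<lambda>xs. Suc (xs ! 1) - triangle (Suc (xs ! 0))) (y # xs) = 0)"
  proof (rule rf_Least)
    show "rf (Suc 1) (\<lambda>xs. Suc (xs ! 1) - triangle (Suc (xs ! 0)))"
      by (intro rf_comp2[OF rf_diff] rf_Suc rf_comp1[OF rf_triangle] rf_proj) auto
    \<comment> \<open>The search stops at \<open>z\<close> at the latest.\<close>
    have "Suc z - triangle (Suc z) = 0" for z by simp
    then show "\<exists>y. Suc ((y # xs) ! 1) - triangle (Suc ((y # xs) ! 0)) = 0" if "length xs = 1" for xs
      by (intro exI[of _ "xs ! 0"]) simp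
  qed
  then show ?thesis by (elim rf_cong) (simp add: pfst_plus_psnd)
qed

text \<open>The first component is the offset of \<open>z\<close> within its diagonal; the second is
  then the rest of the sum.\<close>

lemma pfst_eq: "pfst z = z - triangle (pfst z + psnd z)"
  using pair_pfst_psnd[of z] unfolding pair_def prod_encode_def by simp

lemma rf_pfst: "rf 1 (\<lambda>xs. pfst (xs ! 0))"
  by (subst pfst_eq) (intro rf_comp2[OF rf_diff] rf_comp1[OF rf_triangle] rf_pfst_plus_psnd rf_proj; simp)

lemma rf_psnd: "rf 1 (\<lambda>xs. psnd (xs ! 0))"
proof -
  have "rf 1 (\<lambda>xs. pfst (xs ! 0) + psnd (xs ! 0) - pfst (xs ! 0))"
    by (intro rf_comp2[OF rf_diff] rf_pfst_plus_psnd rf_pfst)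
  then show ?thesis by simp
qed

lemma rf_pair: "rf 2 (\<lambda>xs. pair (xs ! 0) (xs ! 1))"
  unfolding pair_def prod_encode_def
  by simp (intro rf_comp2[OF rf_add] rf_comp1[OF rf_triangle] rf_proj; simp)

lemma recursive_iff_rf: "recursive f \<longleftrightarrow> rf 1 (\<lambda>xs. f (xs ! 0))"
proof
  show "recursive f \<Longrightarrow> rf 1 (\<lambda>xs. f (xs ! 0))"
    unfolding recursive_def rf_def by (auto simp: length_Suc_conv)
  show "rf 1 (\<lambda>xs. f (xs ! 0)) \<Longrightarrow> recursive f"
    unfolding recursive_def rf_def by (metis length_Cons list.size(3) nth_Cons_0 One_nat_def)
qed

text \<open>
  Functions of several variables are treated as unary functions of a coded tuple.  The rules below
  for bound variables replace a pair \<open>(x, y)\<close> of variables by the projections of a single \<open>z\<close>, so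
  that syntax-directed application proves every goal without mentioning arities.
\<close>

named_theorems rec_intros

lemma recursive_comp: "recursive h \<Longrightarrow> recursive f \<Longrightarrow> recursive (\<lambda>x. h (f x))"
  unfolding recursive_iff_rf by (rule rf_comp1)

lemma recursive_binary:
  "rf 2 (\<lambda>xs. h (xs ! 0) (xs ! 1)) \<Longrightarrow> recursive f \<Longrightarrow> recursive g \<Longrightarrow> recursive (\<lambda>x. h (f x) (g x))"
  unfolding recursive_iff_rf by (rule rf_comp2)

lemma recursive_id [rec_intros]: "recursive (\<lambda>x. x)"
  unfolding recursive_iff_rf by (rule rf_proj) simp

lemma recursive_const [rec_intros]: "recursive (\<lambda>x. c)"
  unfolding recursive_iff_rf by (rule rf_const)

lemma recursive_Suc [rec_intros]: "recursive f \<Longrightarrow> recursive (\<lambda>x. Suc (f x))"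
  unfolding recursive_iff_rf by (rule rf_Suc)

lemma recursive_add [rec_intros]: "recursive f \<Longrightarrow> recursive g \<Longrightarrow> recursive (\<lambda>x. f x + g x)"
  by (rule recursive_binary[OF rf_add])

lemma recursive_diff [rec_intros]: "recursive f \<Longrightarrow> recursive g \<Longrightarrow> recursive (\<lambda>x. f x - g x)"
  by (rule recursive_binary[OF rf_diff])

lemma recursive_pair [rec_intros]: "recursive f \<Longrightarrow> recursive g \<Longrightarrow> recursive (\<lambda>x. pair (f x) (g x))"
  by (rule recursive_binary[OF rf_pair])

lemma recursive_pfst [rec_intros]: "recursive f \<Longrightarrow> recursive (\<lambda>x. pfst (f x))"
  unfolding recursive_iff_rf by (rule rf_comp1[OF rf_pfst])

lemma recursive_psnd [rec_intros]: "recursive f \<Longrightarrow> recursive (\<lambda>x. psnd (f x))"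
  unfolding recursive_iff_rf by (rule rf_comp1[OF rf_psnd])

lemma recursive_rec_nat [rec_intros]:
  assumes "recursive b" "recursive n"
    and "recursive (\<lambda>z. s (pfst z) (pfst (psnd z)) (psnd (psnd z)))"
  shows "recursive (\<lambda>x. rec_nat (b x) (\<lambda>m r. s x m r) (n x))"
proof -
  let ?s = "\<lambda>z. s (pfst z) (pfst (psnd z)) (psnd (psnd z))"
  \<comment> \<open>The recursion scheme passes the list \<open>[m, r, x]\<close> with the parameter
    last, whereas the assumption expects the tuple in the order x, m, r.\<close>
  have "rf 3 (\<lambda>xs. ?s (pair (xs ! 2) (pair (xs ! 0) (xs ! 1))))"
    by (rule rf_comp1[of ?s], use assms(3) in \<open>simp add: recursive_iff_rf\<close>)
      (intro rf_comp2[OF rf_pair] rf_proj; simp)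
  then have "rf (Suc 1) (\<lambda>xs. rec_nat ((\<lambda>xs. b (xs ! 0)) (tl xs))
      (\<lambda>m r. (\<lambda>xs. s (xs ! 2) (xs ! 0) (xs ! 1)) (m # r # tl xs)) (hd xs))"
    by (intro rf_rec_nat) (use assms(1) in \<open>simp_all add: recursive_iff_rf numeral_3_eq_3\<close>)
  then have "rf 2 (\<lambda>xs. rec_nat (b (xs ! 1)) (\<lambda>m r. s (xs ! 1) m r) (xs ! 0))"
    unfolding Suc_1 by (elim rf_cong) (auto elim!: length_2E)
  \<comment> \<open>The same \<open>x\<close> serves twice: through \<open>n\<close> as the number
    of iterations, and as the parameter.\<close>
  from recursive_binary[OF this assms(2) recursive_id] show ?thesis .
qed

lemma recursive_Least_zero:
  assumes "recursive (\<lambda>z. f (pfst z) (psnd z))" "\<And>x. \<exists>y. f x y = 0"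
  shows "recursive (\<lambda>x. LEAST y. f x y = (0::nat))"
proof -
  let ?f = "\<lambda>z. f (pfst z) (psnd z)"
  have "rf 2 (\<lambda>xs. ?f (pair (xs ! 1) (xs ! 0)))"
    by (rule rf_comp1[of ?f], use assms(1) in \<open>simp add: recursive_iff_rf\<close>)
      (intro rf_comp2[OF rf_pair] rf_proj; simp)
  then have "rf 1 (\<lambda>xs. LEAST y. (\<lambda>xs. f (xs ! 1) (xs ! 0)) (y # xs) = 0)"
    by (intro rf_Least) (use assms(2) in \<open>simp_all add: numeral_2_eq_2\<close>)
  then show ?thesis unfolding recursive_iff_rf by simp
qed

text \<open>Truth is represented by \<open>0\<close>, the value sought by minimisation.\<close>

definition decidable :: "(nat \<Rightarrow> bool) \<Rightarrow> bool" where
  "decidable P \<longleftrightarrow> recursive (\<lambda>x. if P x then 0 else 1)"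

text \<open>Branching is a recursion on the truth value: 0 yields the base value \<open>f x\<close>,
  and 1 runs a single step that discards it in favour of \<open>g x\<close>.\<close>

lemma recursive_if [rec_intros]:
  assumes "decidable P" "recursive f" "recursive g"
  shows "recursive (\<lambda>x. if P x then f x else g x)"
proof -
  have "recursive (\<lambda>x. rec_nat (f x) (\<lambda>m r. g x) (if P x then 0 else 1))"
    using assms(1) unfolding decidable_def
    by (intro recursive_rec_nat recursive_comp[OF assms(3)] assms(2) recursive_pfst recursive_id)
  moreover have "rec_nat (f x) (\<lambda>m r. g x) (if P x then 0 else 1) = (if P x then f x else g x)" for x
    by simp
  ultimately show ?thesis by simp
qed

lemma decidable_comp: "decidable P \<Longrightarrow> recursive f \<Longrightarrow> decidable (\<lambda>x. P (f x))"
  unfolding decidable_def by (rule recursive_comp)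

lemma if_swap_not: "(if \<not> b then x else y) = (if b then y else x)"
  by simp

lemma decidable_not [rec_intros]: "decidable P \<Longrightarrow> decidable (\<lambda>x. \<not> P x)"
  using recursive_if[OF _ recursive_const[of 1] recursive_const[of 0], of P]
  unfolding decidable_def[of "\<lambda>x. \<not> P x"] by (simp add: if_swap_not)

lemma decidable_conj [rec_intros]:
  assumes "decidable P" "decidable Q" shows "decidable (\<lambda>x. P x \<and> Q x)"
proof -
  have "recursive (\<lambda>x. if P x then if Q x then 0 else 1 else 1)"
    by (intro recursive_if assms recursive_const)
  moreover have "(if P x then if Q x then 0 else 1 else 1) = (if P x \<and> Q x then 0 else (1::nat))" for x
    by simp
  ultimately show ?thesis unfolding decidable_def by simp
qed

lemma decidable_disj [rec_intros]:
  assumes "decidable P" "decidable Q" shows "decidable (\<lambda>x. P x \<or> Q x)"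
proof -
  have "decidable (\<lambda>x. \<not> (\<not> P x \<and> \<not> Q x))" by (intro rec_intros assms)
  then show ?thesis by simp
qed

lemma decidable_imp [rec_intros]:
  assumes "decidable P" "decidable Q" shows "decidable (\<lambda>x. P x \<longrightarrow> Q x)"
proof -
  have "decidable (\<lambda>x. \<not> P x \<or> Q x)" by (intro rec_intros assms)
  then show ?thesis by (simp only: imp_conv_disj)
qed

lemma decidable_eq_0: "recursive f \<Longrightarrow> decidable (\<lambda>x. f x = 0)"
proof -
  assume "recursive f"
  then have "recursive (\<lambda>x. rec_nat 0 (\<lambda>m r. 1) (f x))" by (intro rec_intros)
  moreover have "rec_nat 0 (\<lambda>m r. 1) a = (if a = 0 then 0 else (1::nat))" for a :: nat
    by (cases a) auto
  ultimately show ?thesis unfolding decidable_def by simp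
qed

lemma decidable_le [rec_intros]:
  "recursive f \<Longrightarrow> recursive g \<Longrightarrow> decidable (\<lambda>x. f x \<le> g x)"
  using decidable_eq_0[OF recursive_diff[of f g]] by simp

lemma decidable_less [rec_intros]:
  "recursive f \<Longrightarrow> recursive g \<Longrightarrow> decidable (\<lambda>x. f x < g x)"
  using decidable_le[OF recursive_Suc[of f], of g] by (simp add: Suc_le_eq)

lemma decidable_eq [rec_intros]:
  assumes "recursive f" "recursive g" shows "decidable (\<lambda>x. f x = g x)"
  using decidable_conj[OF decidable_le[OF assms] decidable_le[OF assms(2,1)]]
  by (simp add: eq_iff)

lemma decidable_bex_less [rec_intros]:
  assumes "decidable (\<lambda>z. P (pfst z) (psnd z))" "recursive b"
  shows "decidable (\<lambda>x. \<exists>y<b x. P x y)"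
proof -
  \<comment> \<open>In the step of the recursion the tuple also carries the accumulator; the
    reindexing drops it before \<open>P\<close> is applied.\<close>
  have "decidable (\<lambda>z. (\<lambda>z. P (pfst z) (psnd z)) (pair (pfst z) (pfst (psnd z))))"
    by (rule decidable_comp[OF assms(1)]) (intro rec_intros)
  then have "recursive (\<lambda>x. rec_nat 1 (\<lambda>m r. if P x m then 0 else r) (b x))"
    by (intro rec_intros assms(2)) simp
  moreover have "rec_nat 1 (\<lambda>m r. if P x m then 0 else r) k = (if \<exists>y<k. P x y then 0 else (1::nat))" for x k
    by (induction k) (auto simp: less_Suc_eq)
  ultimately show ?thesis unfolding decidable_def by simp
qed

lemma decidable_ball_less [rec_intros]:
  assumes "decidable (\<lambda>z. P (pfst z) (psnd z))" "recursive b"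
  shows "decidable (\<lambda>x. \<forall>y<b x. P x y)"
proof -
  have "decidable (\<lambda>x. \<not> (\<exists>y<b x. \<not> P x y))" by (intro rec_intros assms)
  then show ?thesis by simp
qed

lemma recursive_Least:
  assumes "decidable (\<lambda>z. P (pfst z) (psnd z))" "\<And>x. \<exists>y. P x y"
  shows "recursive (\<lambda>x. LEAST y. P x y)"
proof -
  have "recursive (\<lambda>x. LEAST y. (if P x y then 0 else (1::nat)) = 0)"
    by (rule recursive_Least_zero) (use assms in \<open>auto simp: decidable_def\<close>)
  moreover have "((if b then 0 else (1::nat)) = 0) = b" for b by simp
  ultimately show ?thesis by simp
qed

section \<open>Multiplication, powers of two and bit sets\<close>

lemma recursive_mult [rec_intros]:
  assumes "recursive f" "recursive g" shows "recursive (\<lambda>x. f x * g x)"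
proof -
  have "recursive (\<lambda>z. g (pfst z))" by (intro recursive_comp[OF assms(2)] rec_intros)
  then have "recursive (\<lambda>x. rec_nat 0 (\<lambda>m r. r + g x) (f x))" by (intro rec_intros assms)
  moreover have "rec_nat 0 (\<lambda>m r. r + b) a = a * b" for a b :: nat by (induction a) auto
  ultimately show ?thesis by simp
qed

lemma recursive_power2 [rec_intros]:
  assumes "recursive f" shows "recursive (\<lambda>x. 2 ^ f x)"
proof -
  have "recursive (\<lambda>x. rec_nat 1 (\<lambda>m r. 2 * r) (f x))" by (intro rec_intros assms)
  moreover have "rec_nat 1 (\<lambda>m r. 2 * r) a = (2::nat) ^ a" for a by (induction a) auto
  ultimately show ?thesis by simp
qed

text \<open>The quotient is found by minimisation. The search is total because the dividend itself
  meets the bound.\<close>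

lemma recursive_div_power2 [rec_intros]:
  assumes "recursive f" "recursive g" shows "recursive (\<lambda>x. f x div 2 ^ g x)"
proof -
  have *: "a div 2 ^ k = (LEAST q. a < Suc q * 2 ^ k)" for a k :: nat
  proof (rule Least_equality[symmetric])
    show "a < Suc (a div 2 ^ k) * 2 ^ k"
      using dividend_less_times_div[of "2 ^ k" a] by (simp add: mult.commute)
    show "a div 2 ^ k \<le> q" if "a < Suc q * 2 ^ k" for q
      using less_mult_imp_div_less[OF that] by simp
  qed
  have "recursive (\<lambda>z. LEAST q. pfst z < Suc q * 2 ^ psnd z)"
  proof (rule recursive_Least)
    have "a * 1 \<le> a * 2 ^ k" for a k :: nat by (intro mult_le_mono2) simp
    then show "\<exists>q. pfst z < Suc q * 2 ^ psnd z" for z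
      by (intro exI[of _ "pfst z"]) (metis Suc_le_eq nat_mult_1_right)
  qed (intro rec_intros)
  from recursive_comp[OF this recursive_pair[OF assms]] show ?thesis by (simp add: *)
qed

lemma recursive_div2 [rec_intros]: "recursive f \<Longrightarrow> recursive (\<lambda>x. f x div 2)"
  using recursive_div_power2[OF _ recursive_const[of 1]] by simp

lemma decidable_odd [rec_intros]: "recursive f \<Longrightarrow> decidable (\<lambda>x. odd (f x))"
proof -
  assume "recursive f"
  then have "decidable (\<lambda>x. f x \<noteq> 2 * (f x div 2))" by (intro rec_intros)
  moreover have "odd a \<longleftrightarrow> a \<noteq> 2 * (a div 2)" for a :: nat by presburger
  ultimately show ?thesis by (simp only:)
qed

text \<open>Membership in a bit set is by definition the parity of the code shifted to the
  right.\<close>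

lemma decidable_mem_set_decode [rec_intros]:
  assumes "recursive f" "recursive g" shows "decidable (\<lambda>x. f x \<in> set_decode (g x))"
  unfolding set_decode_def mem_Collect_eq by (intro rec_intros assms)


section \<open>Lists coded by numbers\<close>

definition list_len :: "nat \<Rightarrow> nat" where "list_len l = length (list_decode l)"
text \<open>A nonempty list is coded by the successor of the pair of its head and the code of its
  tail. Hence \<open>psnd (r - 1)\<close> is the tail and \<open>pfst (r - 1)\<close> the
  head.\<close>

definition list_nth :: "nat \<Rightarrow> nat \<Rightarrow> nat" where
  "list_nth l i = pfst (rec_nat l (\<lambda>m r. psnd (r - 1)) i - 1)"

lemma list_encode_tl: "list_encode (tl (list_decode l)) = psnd (l - 1)"
proof (cases l)
  \<comment> \<open>The empty list must be its own tail: \<open>0 - 1\<close> is 0, and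
    \<open>psnd 0\<close> is 0 because a pair code bounds its components.\<close>
  case 0
  then show ?thesis using le_prod_encode_2[of "psnd 0" "pfst 0"] pair_pfst_psnd[of 0]
    by simp (metis le_prod_encode_2 le_zero_eq pair_def pair_pfst_psnd)
next
  case (Suc m)
  then show ?thesis by (simp add: psnd_def split: prod.split)
qed

lemma rec_nat_list_tl: "rec_nat l (\<lambda>m r. psnd (r - 1)) i = list_encode (drop i (list_decode l))"
proof (induction i)
  case (Suc i)
  then show ?case using list_encode_tl[of "list_encode (drop i (list_decode l))"]
    by (simp add: drop_Suc tl_drop)
qed simp

lemma list_nth_eq: "i < list_len l \<Longrightarrow> list_nth l i = list_decode l ! i"
  unfolding list_nth_def rec_nat_list_tl list_len_def
  by (simp add: Cons_nth_drop_Suc[symmetric] pfst_def)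

text \<open>Only the empty list has code 0, so the length is the number of tails taken until 0
  appears.\<close>

lemma list_len_eq: "list_len l = (LEAST i. rec_nat l (\<lambda>m r. psnd (r - 1)) i = 0)"
proof -
  have "list_encode xs = 0 \<longleftrightarrow> xs = []" for xs by (cases xs) auto
  then show ?thesis
    unfolding rec_nat_list_tl list_len_def by (auto intro!: Least_equality[symmetric])
qed

lemma recursive_list_len [rec_intros]: "recursive f \<Longrightarrow> recursive (\<lambda>x. list_len (f x))"
proof -
  have "recursive (\<lambda>l. LEAST i. rec_nat l (\<lambda>m r. psnd (r - 1)) i = 0)"
  proof (rule recursive_Least)
    show "\<exists>i. rec_nat l (\<lambda>m r. psnd (r - 1)) i = 0" for l
      unfolding rec_nat_list_tl by (rule exI[of _ "length (list_decode l)"]) simp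
  qed (intro rec_intros)
  then show "recursive f \<Longrightarrow> recursive (\<lambda>x. list_len (f x))"
    unfolding list_len_eq[symmetric] by (rule recursive_comp)
qed

lemma recursive_list_nth [rec_intros]:
  "recursive f \<Longrightarrow> recursive g \<Longrightarrow> recursive (\<lambda>x. list_nth (f x) (g x))"
  unfolding list_nth_def by (intro rec_intros)

abbreviation elems :: "nat \<Rightarrow> nat set" where "elems l \<equiv> set (list_decode l)"

lemma bex_elems: "(\<exists>e\<in>elems l. P e) \<longleftrightarrow> (\<exists>i<list_len l. P (list_nth l i))"
  by (metis in_set_conv_nth list_len_def list_nth_eq)

lemma decidable_bex_elems [rec_intros]:
  assumes "decidable (\<lambda>z. P (pfst z) (psnd z))" "recursive l"
  shows "decidable (\<lambda>x. \<exists>e\<in>elems (l x). P x e)"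
proof -
  have "recursive (\<lambda>z. l (pfst z))" by (intro recursive_comp[OF assms(2)] rec_intros)
  then have "decidable (\<lambda>z. (\<lambda>z. P (pfst z) (psnd z)) (pair (pfst z) (list_nth (l (pfst z)) (psnd z))))"
    by (intro decidable_comp[OF assms(1)] rec_intros)
  then show ?thesis unfolding bex_elems by (intro rec_intros assms) simp
qed

text \<open>The indices descend because the recursion on \<open>n\<close> puts the entry of the
  newest index in front.\<close>

definition build :: "nat \<Rightarrow> (nat \<Rightarrow> bool) \<Rightarrow> (nat \<Rightarrow> nat) \<Rightarrow> nat" where
  "build n P f = list_encode (map f (filter P (rev [0..<n])))"

lemma build_eq: "build n P f = rec_nat 0 (\<lambda>i r. if P i then Suc (pair (f i) r) else r) n"
  unfolding build_def by (induction n) (auto simp: pair_def)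

lemma recursive_build:
  assumes "recursive n" "decidable (\<lambda>z. P (pfst z) (psnd z))" "recursive (\<lambda>z. f (pfst z) (psnd z))"
  shows "recursive (\<lambda>x. build (n x) (P x) (f x))"
proof -
  have "decidable (\<lambda>z. (\<lambda>z. P (pfst z) (psnd z)) (pair (pfst z) (pfst (psnd z))))"
    by (rule decidable_comp[OF assms(2)]) (intro rec_intros)
  moreover have "recursive (\<lambda>z. (\<lambda>z. f (pfst z) (psnd z)) (pair (pfst z) (pfst (psnd z))))"
    by (rule recursive_comp[OF assms(3)]) (intro rec_intros)
  ultimately show ?thesis unfolding build_eq by (intro rec_intros assms(1)) simp_all
qed

section \<open>Least fixed points below a bound\<close>

definition bounded_lfp :: "nat \<Rightarrow> (nat set \<Rightarrow> nat set) \<Rightarrow> nat set" where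
  "bounded_lfp b \<Phi> = {j. \<forall>R<2 ^ b. (\<forall>i<b. i \<in> \<Phi> (set_decode R) \<longrightarrow> i \<in> set_decode R) \<longrightarrow> j \<in> set_decode R}"

text \<open>\<open>bounded_lfp\<close> is the intersection of all closed subsets of
  \<open>{..<b}\<close>, with closure tested only below \<open>b\<close> so that all quantifiers are
  bounded. Since the least closed set lies below \<open>b\<close>, this restriction loses
  nothing.\<close>

lemma bounded_lfp_eqI:
  assumes "mono \<Phi>" "\<Phi> P \<subseteq> P" "\<And>S. \<Phi> S \<subseteq> S \<Longrightarrow> P \<subseteq> S" "P \<subseteq> {..<b}"
  shows "bounded_lfp b \<Phi> = P"
proof
  have fin: "finite P" using assms(4) finite_subset by blast
  \<comment> \<open>The code of \<open>P\<close> is below \<open>2 ^ b\<close>, so \<open>P\<close>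
    itself is one of the sets that are intersected.\<close>
  have "set_encode P \<le> set_encode {..<b}"
    unfolding set_encode_def by (rule sum_mono2) (use assms(4) in auto)
  also have "\<dots> < 2 ^ b"
    unfolding set_encode_def by (induction b) auto
  finally show "bounded_lfp b \<Phi> \<subseteq> P"
    unfolding bounded_lfp_def using assms(2) set_encode_inverse[OF fin] by fastforce
  have "P \<subseteq> set_decode R" if "\<forall>i<b. i \<in> \<Phi> (set_decode R) \<longrightarrow> i \<in> set_decode R" for R
  proof -
    \<comment> \<open>Closure of \<open>R\<close> is known only below \<open>b\<close>; intersecting
      with \<open>P\<close> stays there. The intersection is closed by monotonicity, and leastness
      of \<open>P\<close> applies to it.\<close>
    have "\<Phi> (set_decode R \<inter> P) \<subseteq> \<Phi> (set_decode R) \<inter> P"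
      using monoD[OF assms(1), of "set_decode R \<inter> P" P] assms(2)
        monoD[OF assms(1), of "set_decode R \<inter> P" "set_decode R"] by blast
    also have "\<dots> \<subseteq> set_decode R \<inter> P" using that assms(4) by auto
    finally show ?thesis using assms(3) by blast
  qed
  then show "P \<subseteq> bounded_lfp b \<Phi>" unfolding bounded_lfp_def by blast
qed

lemma decidable_bounded_lfp:
  assumes "decidable (\<lambda>z. psnd (psnd z) \<in> \<Phi> (pfst z) (set_decode (pfst (psnd z))))" "recursive b" "recursive f"
  shows "decidable (\<lambda>x. f x \<in> bounded_lfp (b x) (\<Phi> x))"
proof -
  let ?P = "\<lambda>z. psnd (psnd z) \<in> \<Phi> (pfst z) (set_decode (pfst (psnd z)))"
  have b: "recursive (\<lambda>z. b (pfst z))" and f: "recursive (\<lambda>z. f (pfst z))"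
    by (intro recursive_comp[OF assms(2)] recursive_comp[OF assms(3)] rec_intros)+
  \<comment> \<open>The nested quantifiers produce the tuple ((x, R), i), the assumption wants (x,
    (R, i)).\<close>
  have "decidable (\<lambda>z. ?P (pair (pfst (pfst z)) (pair (psnd (pfst z)) (psnd z))))"
    by (rule decidable_comp[OF assms(1)]) (intro rec_intros)
  then show ?thesis
    unfolding bounded_lfp_def mem_Collect_eq
    by (intro rec_intros assms b f) simp
qed

section \<open>Finite trees and satisfiability of solved formulas\<close>

lemma positions_eq:
  "{p. is_position p t} =
    insert [] (\<Union>i<length (children t). Cons i ` {p. is_position p (children t ! i)})"
proof -
  have "is_position p t \<longleftrightarrow>
    p \<in> insert [] (\<Union>i<length (children t). Cons i ` {p. is_position p (children t ! i)})" for p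
    by (cases p) auto
  then show ?thesis by blast
qed

lemma finite_tree_iff: "finite_tree t \<longleftrightarrow> (\<forall>s\<in>set (children t). finite_tree s)"
proof -
  have "finite_tree t \<longleftrightarrow> (\<forall>i<length (children t). finite_tree (children t ! i))"
    unfolding finite_tree_def by (subst positions_eq) (auto simp: finite_image_iff)
  then show ?thesis by (auto simp: all_set_conv_all_nth)
qed

text \<open>Induction on the number of positions: the positions of a child embed into those of the
  tree and miss the root.\<close>

lemma finite_tree_induct [consumes 1, case_names node]:
  assumes "finite_tree t"
    and "\<And>t. (\<And>s. s \<in> set (children t) \<Longrightarrow> P s) \<Longrightarrow> P t"
  shows "P t"
  using assms(1)
proof (induction "card {p. is_position p t}" arbitrary: t rule: less_induct)
  case less
  show ?case
  proof (rule assms(2))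
    fix s assume s: "s \<in> set (children t)"
    then obtain i where i: "i < length (children t)" "s = children t ! i" by (auto simp: in_set_conv_nth)
    have "Cons i ` {p. is_position p s} \<subset> {p. is_position p t}"
      using i by (subst (2) positions_eq) auto
    then have "card (Cons i ` {p. is_position p s}) < card {p. is_position p t}"
      using less.prems by (intro psubset_card_mono) (auto simp: finite_tree_def)
    then show "P s"
      using less s finite_tree_iff[of t] by (simp add: card_image)
  qed
qed

section \<open>Inhabitants of sorts and corecursive models of solved formulas\<close>

primcorec sort_tree :: "('s, 'g) signature \<Rightarrow> 's \<Rightarrow> 'g tree" where
  "sort_tree \<Sigma> s = (let g = SOME g. g \<in> gens \<Sigma> \<and> res \<Sigma> g = s
     in Node g (map (sort_tree \<Sigma>) (args \<Sigma> g)))"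

text \<open>Every sort has a generator, and fixing one for each sort lets the tree be grown forever;
  well-sortedness is coinductive, so no finite tree is needed.\<close>

lemma tree_of_sort_sort_tree:
  assumes "wf_signature \<Sigma>" "s \<in> sorts \<Sigma>"
  shows "tree_of_sort \<Sigma> s (sort_tree \<Sigma> s)"
proof -
  have "tree_of_sort \<Sigma> s t" if "s \<in> sorts \<Sigma> \<and> t = sort_tree \<Sigma> s" for s t
    using that
  proof (coinduction arbitrary: s t rule: tree_of_sort.coinduct)
    case tree_of_sort
    define g where "g = (SOME g. g \<in> gens \<Sigma> \<and> res \<Sigma> g = s)"
    have "\<exists>g. g \<in> gens \<Sigma> \<and> res \<Sigma> g = s"
      using assms(1) tree_of_sort unfolding wf_signature_def by blast
    then have g: "g \<in> gens \<Sigma>" "res \<Sigma> g = s"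
      unfolding g_def by (metis (mono_tags, lifting) someI_ex)+
    have "set (args \<Sigma> g) \<subseteq> sorts \<Sigma>" using g assms(1) unfolding wf_signature_def by blast
    then show ?case
      using tree_of_sort g
      by (intro exI[of _ g] exI[of _ "map (sort_tree \<Sigma>) (args \<Sigma> g)"])
        (auto simp: sort_tree.code[of \<Sigma> s] g_def[symmetric] list_all2_conv_all_nth)
  qed
  then show ?thesis using assms(2) by blast
qed

text \<open>Corecursive solution of a system: \<open>q x\<close> is the equation for
  \<open>x\<close>, if there is one, and \<open>p x\<close> the prescribed tree of a variable
  without equation.\<close>

primcorec solve :: "(nat \<Rightarrow> ('g \<times> nat list) option) \<Rightarrow> (nat \<Rightarrow> 'g tree) \<Rightarrow> nat \<Rightarrow> 'g tree" where
  "label (solve q p x) = (case q x of Some gz \<Rightarrow> fst gz | None \<Rightarrow> label (p x))"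
| "children (solve q p x) = (case q x of Some gz \<Rightarrow> map (solve q p) (snd gz) | None \<Rightarrow> children (p x))"

lemma solve_Some: "q x = Some (g, zs) \<Longrightarrow> solve q p x = Node g (map (solve q p) zs)"
  by (rule tree.expand) simp

lemma solve_None: "q x = None \<Longrightarrow> solve q p x = p x"
  by (rule tree.expand) simp

text \<open>Follows equations between variables. The guard \<open>y < x\<close> ensures termination
  for every \<open>m\<close>; the ordering condition on solved formulas makes it hold
  throughout.\<close>

fun deref :: "(nat \<Rightarrow> 'g rhs option) \<Rightarrow> nat \<Rightarrow> nat" where
  "deref m x = (case m x of Some (Var y) \<Rightarrow> if y < x then deref m y else x | _ \<Rightarrow> x)"

declare deref.simps [simp del]

lemma solved_satisfiable:
  assumes "wf_signature \<Sigma>" "set \<sigma> \<subseteq> sorts \<Sigma>" "basic_formula \<Sigma> \<sigma> \<beta>" "solved \<Sigma> \<sigma> \<beta>"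
  obtains \<rho> where "assignment \<Sigma> \<sigma> \<rho>" "satisfies \<rho> \<beta>"
proof -
  define m where "m = map_of (fst \<beta>)"
  \<comment> \<open>The generator equation at the end of the chain of variable equations starting in
    \<open>x\<close>.\<close>
  define q where "q x = (case m (deref m x) of Some (App g zs) \<Rightarrow> Some (g, zs) | _ \<Rightarrow> None)" for x
  \<comment> \<open>Free variables under \<open>fin\<close> receive a finite tree, which the sort
    condition of \<open>solved\<close> provides; the others receive any tree of their sort.\<close>
  define P where "P r = (if r \<in> set (snd \<beta>) then SOME t. tree_of_sort \<Sigma> (\<sigma> ! r) t \<and> finite_tree t
    else sort_tree \<Sigma> (\<sigma> ! r))" for r
  define \<rho> where "\<rho> = solve q (\<lambda>x. P (deref m x))"
  have dist: "distinct (map fst (fst \<beta>))" and disj: "fst ` set (fst \<beta>) \<inter> set (snd \<beta>) = {}"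
    and ord: "\<And>x y. (x, Var y) \<in> set (fst \<beta>) \<Longrightarrow> y < x"
    and fins: "\<And>v. v \<in> set (snd \<beta>) \<Longrightarrow> has_finite_tree \<Sigma> (\<sigma> ! v)"
    using assms(4) unfolding solved_def by auto
  have m: "m x = Some t \<longleftrightarrow> (x, t) \<in> set (fst \<beta>)" for x t
    unfolding m_def using dist by simp
  have bvar: "x < length \<sigma> \<and> y < length \<sigma> \<and> \<sigma> ! y = \<sigma> ! x" if "(x, Var y) \<in> set (fst \<beta>)" for x y
    using assms(3) that unfolding basic_formula_def by fastforce
  have bapp: "g \<in> gens \<Sigma> \<and> res \<Sigma> g = \<sigma> ! x \<and> (\<forall>z\<in>set zs. z < length \<sigma>) \<and> map (\<lambda>z. \<sigma> ! z) zs = args \<Sigma> g"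
    if "(x, App g zs) \<in> set (fst \<beta>)" for x g zs
    using assms(3) that unfolding basic_formula_def by fastforce
  have deref_var: "deref m x = deref m y" if "(x, Var y) \<in> set (fst \<beta>)" for x y
    using that ord[OF that] by (subst deref.simps) (simp add: m[symmetric])
  have deref_id: "deref m x = x" if "\<And>y. (x, Var y) \<notin> set (fst \<beta>)" for x
    using that by (subst deref.simps) (auto simp: m split: option.split rhs.split)
  \<comment> \<open>Root and children of \<open>\<rho> x\<close> depend on \<open>x\<close> only
    through \<open>deref m x\<close>, so one expansion suffices and no bisimulation is
    required.\<close>
  have \<rho>_cong: "\<rho> x = \<rho> y" if "deref m x = deref m y" for x y
    unfolding \<rho>_def by (rule tree.expand) (simp add: q_def that split: option.split rhs.split)
  have deref: "deref m x < length \<sigma> \<and> \<sigma> ! deref m x = \<sigma> ! x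
      \<and> (\<forall>y. (deref m x, Var y) \<notin> set (fst \<beta>))" if "x < length \<sigma>" for x
    using that
  proof (induction x rule: less_induct)
    case (less x)
    show ?case
    proof (cases "\<exists>y. (x, Var y) \<in> set (fst \<beta>)")
      case True
      then obtain y where y: "(x, Var y) \<in> set (fst \<beta>)" by blast
      then show ?thesis using less.IH[OF ord[OF y]] bvar[OF y] deref_var[OF y] by simp
    next
      case False
      then show ?thesis using less.prems deref_id by auto
    qed
  qed
  have P: "tree_of_sort \<Sigma> (\<sigma> ! r) (P r) \<and> (r \<in> set (snd \<beta>) \<longrightarrow> finite_tree (P r))" if "r < length \<sigma>" for r
  proof (cases "r \<in> set (snd \<beta>)")
    case True
    then show ?thesis
      using someI_ex[OF fins[OF True, unfolded has_finite_tree_def]] by (simp add: P_def)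
  next
    case False
    then show ?thesis
      using tree_of_sort_sort_tree[OF assms(1), of "\<sigma> ! r"] nth_mem[OF that] assms(2)
      by (auto simp: P_def)
  qed
  have "assignment \<Sigma> \<sigma> \<rho>"
    unfolding assignment_def
  proof (intro allI impI)
    fix x assume "x < length \<sigma>"
    \<comment> \<open>Coinduction for all variables at once: the children of an unfolded variable
      are again values of variables, while those of a free variable are already known to be
      well-sorted.\<close>
    have "tree_of_sort \<Sigma> s t" if "\<exists>x<length \<sigma>. s = \<sigma> ! x \<and> t = \<rho> x" for s t
      using that
    proof (coinduction arbitrary: s t rule: tree_of_sort.coinduct)
      case (tree_of_sort s t)
      then obtain x where x: "x < length \<sigma>" "s = \<sigma> ! x" "t = \<rho> x" by blast
      show ?case
      proof (cases "q x")
        case None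
        then have "tree_of_sort \<Sigma> s t"
          using P[of "deref m x"] deref[OF x(1)] x by (simp add: \<rho>_def solve_None)
        then show ?thesis by cases (auto elim!: list_all2_mono)
      next
        case (Some gz)
        obtain g zs where gz: "gz = (g, zs)" by fastforce
        have "(deref m x, App g zs) \<in> set (fst \<beta>)"
          using Some unfolding gz q_def m[symmetric] by (auto split: option.splits rhs.splits)
        note app = bapp[OF this]
        have "list_all2 (\<lambda>s t. (\<exists>x<length \<sigma>. s = \<sigma> ! x \<and> t = \<rho> x) \<or> tree_of_sort \<Sigma> s t)
            (map (\<lambda>z. \<sigma> ! z) zs) (map \<rho> zs)"
          using conjunct1[OF conjunct2[OF conjunct2[OF app]]] by (auto simp: list_all2_conv_all_nth)
        moreover have "t = Node g (map \<rho> zs)"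
          using x Some unfolding gz \<rho>_def by (simp add: solve_Some)
        ultimately show ?thesis
          using x deref[OF x(1)] app by (intro exI[of _ g] exI[of _ "map \<rho> zs"]) simp
      qed
    qed
    then show "tree_of_sort \<Sigma> (\<sigma> ! x) (\<rho> x)" using \<open>x < length \<sigma>\<close> by blast
  qed
  moreover have "\<rho> v = eval_rhs \<rho> t" if "(v, t) \<in> set (fst \<beta>)" for v t
  proof (cases t)
    case (Var y)
    then show ?thesis using that deref_var by (auto intro!: \<rho>_cong)
  next
    case (App g zs)
    then have mv: "m v = Some (App g zs)" using that m by simp
    then have "deref m v = v" by (subst deref.simps) simp
    then have "q v = Some (g, zs)" unfolding q_def using mv by simp
    then show ?thesis using App by (simp add: \<rho>_def solve_Some)
  qed
  moreover have "finite_tree (\<rho> u)" if "u \<in> set (snd \<beta>)" for u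
  proof -
    have u: "u < length \<sigma>" using assms(3) that unfolding basic_formula_def by blast
    \<comment> \<open>By distinctness a variable under \<open>fin\<close> heads no equation, so it
      is the end of its own chain and keeps the finite tree \<open>P u\<close>.\<close>
    have "(u, t) \<notin> set (fst \<beta>)" for t using disj that by force
    then have "m u = None" using m by (metis not_Some_eq)
    moreover from this have "deref m u = u" by (subst deref.simps) simp
    ultimately have "\<rho> u = P u" unfolding \<rho>_def by (subst solve_None) (auto simp: q_def)
    then show ?thesis using P[OF u] that by simp
  qed
  ultimately show ?thesis
    by (intro that) (auto simp: satisfies_def)
qed

section \<open>The algorithm\<close>

text \<open>
  Equations are handled through their codes \<open>pair v c\<close>: \<^const>\<open>sum_encode\<close> makes \<open>c\<close> even for a
  variable and odd for a term \<open>g(z\<^sub>1, \<dots>)\<close>.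
\<close>

definition is_app :: "nat \<Rightarrow> bool" where "is_app e \<longleftrightarrow> odd (psnd e)"
definition target :: "nat \<Rightarrow> nat" where "target e = psnd e div 2"
definition gen_of :: "nat \<Rightarrow> nat" where "gen_of e = pfst (target e)"
definition args_of :: "nat \<Rightarrow> nat" where "args_of e = psnd (target e)"

lemma recursive_eq_parts [rec_intros]:
  assumes "recursive f"
  shows "recursive (\<lambda>x. target (f x))" "recursive (\<lambda>x. gen_of (f x))" "recursive (\<lambda>x. args_of (f x))"
    "decidable (\<lambda>x. is_app (f x))"
  unfolding target_def gen_of_def args_of_def is_app_def by (intro rec_intros assms)+

text \<open>The bounds by \<open>n\<close> in the rules make the relation finite for arbitrary \<open>E\<close>.\<close>

inductive eqv :: "nat \<Rightarrow> nat set \<Rightarrow> nat \<Rightarrow> nat \<Rightarrow> bool" for n E where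
  refl: "x < n \<Longrightarrow> eqv n E x x"
| sym: "eqv n E x y \<Longrightarrow> eqv n E y x"
| trans: "eqv n E x y \<Longrightarrow> eqv n E y z \<Longrightarrow> eqv n E x z"
| var: "e \<in> E \<Longrightarrow> \<not> is_app e \<Longrightarrow> pfst e < n \<Longrightarrow> target e < n \<Longrightarrow> eqv n E (pfst e) (target e)"
| app: "e \<in> E \<Longrightarrow> f \<in> E \<Longrightarrow> is_app e \<Longrightarrow> is_app f \<Longrightarrow> gen_of e = gen_of f \<Longrightarrow>
    eqv n E (pfst e) (pfst f) \<Longrightarrow> i < list_len (args_of e) \<Longrightarrow> i < list_len (args_of f) \<Longrightarrow>
    list_nth (args_of e) i < n \<Longrightarrow> list_nth (args_of f) i < n \<Longrightarrow>
    eqv n E (list_nth (args_of e) i) (list_nth (args_of f) i)"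

lemma eqv_bounded: "eqv n E x y \<Longrightarrow> x < n \<and> y < n"
  by (induction rule: eqv.induct) auto

text \<open>The rules of \<open>eqv\<close> as an operator on sets of coded pairs, arranged so that
  every quantifier is bounded by \<open>n\<close>, by \<open>E\<close> or by a list length.\<close>

definition eqv_step :: "nat \<Rightarrow> nat set \<Rightarrow> nat set \<Rightarrow> nat set" where
  "eqv_step n E S = {j. pfst j < n \<and> psnd j < n \<and>
    (pfst j = psnd j \<or> pair (psnd j) (pfst j) \<in> S \<or>
     (\<exists>y<n. pair (pfst j) y \<in> S \<and> pair y (psnd j) \<in> S) \<or>
     (\<exists>e\<in>E. \<not> is_app e \<and> pfst j = pfst e \<and> psnd j = target e) \<or>
     (\<exists>e\<in>E. \<exists>f\<in>E. is_app e \<and> is_app f \<and> gen_of e = gen_of f \<and> pair (pfst e) (pfst f) \<in> S \<and>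
        (\<exists>i<list_len (args_of e). i < list_len (args_of f) \<and>
           pfst j = list_nth (args_of e) i \<and> psnd j = list_nth (args_of f) i)))}"

text \<open>Pairing is monotone, so all pairs of numbers below \<open>n\<close> have codes at most
  \<open>pair n n\<close>.\<close>

lemma eqv_eq_bounded_lfp:
  "eqv n E x y \<longleftrightarrow> pair x y \<in> bounded_lfp (Suc (pair n n)) (eqv_step n E)"
proof -
  have "bounded_lfp (Suc (pair n n)) (eqv_step n E) = {j. eqv n E (pfst j) (psnd j)}"
  proof (rule bounded_lfp_eqI)
    show "mono (eqv_step n E)"
      by (rule monoI) (unfold eqv_step_def, blast)
    show "eqv_step n E {j. eqv n E (pfst j) (psnd j)} \<subseteq> {j. eqv n E (pfst j) (psnd j)}"
      unfolding eqv_step_def by (auto intro: eqv.intros)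
    show "{j. eqv n E (pfst j) (psnd j)} \<subseteq> {..<Suc (pair n n)}"
    proof
      fix j assume "j \<in> {j. eqv n E (pfst j) (psnd j)}"
      then show "j \<in> {..<Suc (pair n n)}"
        using eqv_bounded[of n E "pfst j" "psnd j"] pair_mono[of "pfst j" n "psnd j" n] by simp
    qed
    fix S assume S: "eqv_step n E S \<subseteq> S"
    have "pair x y \<in> S" if "eqv n E x y" for x y
      using that
    proof (induction rule: eqv.induct)
      case (trans x y z)
      then show ?case using eqv_bounded[OF trans(1)] eqv_bounded[OF trans(2)]
        by (intro subsetD[OF S]) (auto simp: eqv_step_def)
    next
      case (sym x y)
      then show ?case using eqv_bounded[OF sym(1)]
        by (intro subsetD[OF S]) (auto simp: eqv_step_def)
    next
      case (app e f i)
      then show ?case by (intro subsetD[OF S]) (unfold eqv_step_def, simp, blast)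
    qed (intro subsetD[OF S], force simp: eqv_step_def)+
    from this[of "pfst j" "psnd j" for j]
    show "{j. eqv n E (pfst j) (psnd j)} \<subseteq> S" by auto
  qed
  then show ?thesis by simp
qed

lemma decidable_eqv [rec_intros]:
  assumes "recursive n" "recursive l" "recursive f" "recursive g"
  shows "decidable (\<lambda>x. eqv (n x) (elems (l x)) (f x) (g x))"
proof -
  \<comment> \<open>All parameters are first projections of one number, so that the rules for bound
    variables meet no unknown functions; arbitrary recursive arguments are composed in afterwards.
    The decidability proofs below take the same detour.\<close>
  have "decidable (\<lambda>z. psnd z \<in> bounded_lfp (Suc (pair (pfst (pfst z)) (pfst (pfst z))))
      (eqv_step (pfst (pfst z)) (elems (psnd (pfst z)))))"
    by (rule decidable_bounded_lfp) (unfold eqv_step_def mem_Collect_eq, (intro rec_intros)+)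
  then have "decidable (\<lambda>x. (\<lambda>z. psnd z \<in> bounded_lfp (Suc (pair (pfst (pfst z)) (pfst (pfst z))))
      (eqv_step (pfst (pfst z)) (elems (psnd (pfst z))))) (pair (pair (n x) (l x)) (pair (f x) (g x))))"
    by (rule decidable_comp) (intro rec_intros assms)
  then show ?thesis unfolding eqv_eq_bounded_lfp by simp
qed

section \<open>Unfolding of classes and the two finiteness closures\<close>

definition sub :: "nat \<Rightarrow> nat set \<Rightarrow> nat \<Rightarrow> nat \<Rightarrow> bool" where
  "sub n E x y \<longleftrightarrow> (\<exists>e\<in>E. is_app e \<and> eqv n E (pfst e) x \<and> (\<exists>z\<in>elems (args_of e). eqv n E z y))"

definition det :: "nat \<Rightarrow> nat set \<Rightarrow> nat \<Rightarrow> bool" where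
  "det n E x \<longleftrightarrow> (\<exists>e\<in>E. is_app e \<and> eqv n E (pfst e) x)"

lemma decidable_sub [rec_intros]:
  assumes "recursive n" "recursive l" "recursive f" "recursive g"
  shows "decidable (\<lambda>x. sub (n x) (elems (l x)) (f x) (g x))"
proof -
  have "decidable (\<lambda>z. sub (pfst (pfst z)) (elems (psnd (pfst z))) (pfst (psnd z)) (psnd (psnd z)))"
    unfolding sub_def by (intro rec_intros)
  from decidable_comp[OF this, of "\<lambda>x. pair (pair (n x) (l x)) (pair (f x) (g x))"]
  show ?thesis by (simp add: rec_intros assms)
qed

lemma decidable_det [rec_intros]:
  assumes "recursive n" "recursive l" "recursive f"
  shows "decidable (\<lambda>x. det (n x) (elems (l x)) (f x))"
proof -
  have "decidable (\<lambda>z. det (pfst (pfst z)) (elems (psnd (pfst z))) (psnd z))"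
    unfolding det_def by (intro rec_intros)
  from decidable_comp[OF this, of "\<lambda>x. pair (pair (n x) (l x)) (f x)"]
  show ?thesis by (simp add: rec_intros assms)
qed

text \<open>Subtrees of finite trees are finite, so the demands in \<open>F\<close> spread along
  \<open>sub\<close>.\<close>

inductive must_fin :: "nat \<Rightarrow> nat set \<Rightarrow> nat set \<Rightarrow> nat \<Rightarrow> bool" for n E F where
  base: "u \<in> F \<Longrightarrow> eqv n E u x \<Longrightarrow> must_fin n E F x"
| sub: "must_fin n E F x \<Longrightarrow> sub n E x y \<Longrightarrow> must_fin n E F y"

lemma must_fin_bounded: "must_fin n E F x \<Longrightarrow> x < n"
  by (induction rule: must_fin.induct) (auto simp: sub_def dest: eqv_bounded)

lemma must_fin_eq_bounded_lfp:
  "must_fin n E F x \<longleftrightarrow>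
    x \<in> bounded_lfp n (\<lambda>S. {x. (\<exists>u\<in>F. eqv n E u x) \<or> (\<exists>y<n. y \<in> S \<and> sub n E y x)})"
proof -
  let ?\<Phi> = "\<lambda>S. {x. (\<exists>u\<in>F. eqv n E u x) \<or> (\<exists>y<n. y \<in> S \<and> sub n E y x)}"
  have "bounded_lfp n ?\<Phi> = {x. must_fin n E F x}"
  proof (rule bounded_lfp_eqI)
    show "mono ?\<Phi>" by (rule monoI) blast
    show "?\<Phi> {x. must_fin n E F x} \<subseteq> {x. must_fin n E F x}" by (auto intro: must_fin.intros)
    show "{x. must_fin n E F x} \<subseteq> {..<n}" using must_fin_bounded by auto
    fix S assume S: "?\<Phi> S \<subseteq> S"
    have "x \<in> S" if "must_fin n E F x" for x
      using that by (induction rule: must_fin.induct) (use S must_fin_bounded in blast)+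
    then show "{x. must_fin n E F x} \<subseteq> S" by blast
  qed
  then show ?thesis by simp
qed

lemma decidable_must_fin [rec_intros]:
  assumes "recursive n" "recursive l" "recursive k" "recursive f"
  shows "decidable (\<lambda>x. must_fin (n x) (elems (l x)) (elems (k x)) (f x))"
proof -
  have "decidable (\<lambda>z. must_fin (pfst (pfst z)) (elems (psnd (pfst z))) (elems (pfst (psnd z))) (psnd (psnd z)))"
    unfolding must_fin_eq_bounded_lfp
    by (rule decidable_bounded_lfp) (unfold mem_Collect_eq, (intro rec_intros)+)
  from decidable_comp[OF this, of "\<lambda>x. pair (pair (n x) (l x)) (pair (k x) (f x))"]
  show ?thesis by (simp add: rec_intros assms)
qed

text \<open>Being inductive, this excludes cycles of \<open>sub\<close> reachable from
  \<open>x\<close>. The sort test \<open>D\<close> decides only at classes without generator;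
  elsewhere finiteness depends on the arguments alone.\<close>

inductive can_fin :: "nat \<Rightarrow> nat set \<Rightarrow> (nat \<Rightarrow> bool) \<Rightarrow> nat \<Rightarrow> bool" for n E D where
  "x < n \<Longrightarrow> det n E x \<or> D x \<Longrightarrow> (\<And>y. y < n \<Longrightarrow> sub n E x y \<Longrightarrow> can_fin n E D y) \<Longrightarrow> can_fin n E D x"

lemma can_fin_eq_bounded_lfp:
  "can_fin n E D x \<longleftrightarrow>
    x \<in> bounded_lfp n (\<lambda>S. {x. x < n \<and> (det n E x \<or> D x) \<and> (\<forall>y<n. sub n E x y \<longrightarrow> y \<in> S)})"
proof -
  let ?\<Phi> = "\<lambda>S. {x. x < n \<and> (det n E x \<or> D x) \<and> (\<forall>y<n. sub n E x y \<longrightarrow> y \<in> S)}"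
  have "bounded_lfp n ?\<Phi> = {x. can_fin n E D x}"
  proof (rule bounded_lfp_eqI)
    show "mono ?\<Phi>" by (rule monoI) blast
    show "?\<Phi> {x. can_fin n E D x} \<subseteq> {x. can_fin n E D x}" by (auto intro: can_fin.intros)
    show "{x. can_fin n E D x} \<subseteq> {..<n}" by (auto elim: can_fin.cases)
    fix S assume S: "?\<Phi> S \<subseteq> S"
    have "x \<in> S" if "can_fin n E D x" for x
      using that by (induction rule: can_fin.induct) (use S in blast)
    then show "{x. can_fin n E D x} \<subseteq> S" by blast
  qed
  then show ?thesis by simp
qed

lemma decidable_can_fin:
  assumes "decidable (\<lambda>z. D (pfst z) (psnd z))" "recursive n" "recursive l" "recursive k" "recursive f"
  shows "decidable (\<lambda>x. can_fin (n x) (elems (l x)) (D (k x)) (f x))"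
proof -
  have "decidable (\<lambda>z. (\<lambda>z. D (pfst z) (psnd z)) (pair (pfst (psnd (pfst z))) (psnd (psnd z))))"
    by (rule decidable_comp[OF assms(1)]) (intro rec_intros)
  then have D: "decidable (\<lambda>z. D (pfst (psnd (pfst z))) (psnd (psnd z)))" by simp
  have "decidable (\<lambda>z. can_fin (pfst (pfst z)) (elems (psnd (pfst z))) (D (pfst (psnd z))) (psnd (psnd z)))"
    unfolding can_fin_eq_bounded_lfp
    by (rule decidable_bounded_lfp) (unfold mem_Collect_eq, (intro rec_intros D)+)
  from decidable_comp[OF this, of "\<lambda>x. pair (pair (n x) (l x)) (pair (k x) (f x))"]
  show ?thesis by (simp add: rec_intros assms)
qed

section \<open>The code of the output\<close>

definition clash :: "nat \<Rightarrow> nat set \<Rightarrow> bool" where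
  "clash n E \<longleftrightarrow> (\<exists>e\<in>E. \<exists>f\<in>E. is_app e \<and> is_app f \<and> eqv n E (pfst e) (pfst f) \<and> gen_of e \<noteq> gen_of f)"

text \<open>
  The second disjuncts in \<open>rep\<close> and \<open>pick\<close> make the minimisations total.
\<close>

definition rep :: "nat \<Rightarrow> nat set \<Rightarrow> nat \<Rightarrow> nat" where
  "rep n E x = (LEAST y. eqv n E x y \<or> y = x)"

definition pick :: "nat \<Rightarrow> nat set \<Rightarrow> nat \<Rightarrow> nat" where
  "pick n E x = (LEAST c. (\<exists>e\<in>E. is_app e \<and> eqv n E (pfst e) x \<and> psnd e = c) \<or> \<not> det n E x)"

text \<open>\<open>2 * rep n E x\<close> is the code of a variable as right-hand side, since
  \<open>sum_encode\<close> doubles left injections; \<open>pick\<close> is already the code of a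
  term. The test \<open>I\<close> drops \<open>fin\<close> where all trees of the sort are finite:
  there it is vacuous and would violate solvedness.\<close>

definition solution_code :: "(nat \<Rightarrow> bool) \<Rightarrow> (nat \<Rightarrow> bool) \<Rightarrow> nat \<Rightarrow> nat set \<Rightarrow> nat set \<Rightarrow> nat" where
  "solution_code D I n E F =
    (if clash n E \<or> (\<exists>u\<in>F. \<not> can_fin n E D u) then 0
     else Suc (pair
       (build n (\<lambda>x. rep n E x \<noteq> x \<or> det n E x)
         (\<lambda>x. pair x (if rep n E x \<noteq> x then 2 * rep n E x else pick n E x)))
       (build n (\<lambda>x. must_fin n E F x \<and> rep n E x = x \<and> \<not> det n E x \<and> I x) (\<lambda>x. x))))"

lemma recursive_rep [rec_intros]:
  assumes "recursive n" "recursive l" "recursive f"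
  shows "recursive (\<lambda>x. rep (n x) (elems (l x)) (f x))"
proof -
  have "recursive (\<lambda>z. rep (pfst (pfst z)) (elems (psnd (pfst z))) (psnd z))"
    unfolding rep_def by (rule recursive_Least) (intro rec_intros, blast)
  from recursive_comp[OF this, of "\<lambda>x. pair (pair (n x) (l x)) (f x)"]
  show ?thesis by (simp add: rec_intros assms)
qed

lemma recursive_pick [rec_intros]:
  assumes "recursive n" "recursive l" "recursive f"
  shows "recursive (\<lambda>x. pick (n x) (elems (l x)) (f x))"
proof -
  have "recursive (\<lambda>z. pick (pfst (pfst z)) (elems (psnd (pfst z))) (psnd z))"
    unfolding pick_def by (rule recursive_Least) (intro rec_intros, auto simp: det_def)
  from recursive_comp[OF this, of "\<lambda>x. pair (pair (n x) (l x)) (f x)"]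
  show ?thesis by (simp add: rec_intros assms)
qed

lemma recursive_solution_code:
  assumes D: "decidable (\<lambda>z. D (pfst z) (psnd z))" and I: "decidable (\<lambda>z. I (pfst z) (psnd z))"
  shows "recursive (\<lambda>x. solution_code (D (pfst x)) (I (pfst x)) (list_len (pfst x))
    (elems (pfst (psnd x))) (elems (psnd (psnd x))))"
proof -
  have I': "decidable (\<lambda>z. (\<lambda>z. I (pfst z) (psnd z)) (pair (pfst (pfst z)) (psnd z)))"
    by (rule decidable_comp[OF I]) (intro rec_intros)
  show ?thesis
    unfolding solution_code_def clash_def
    by (intro rec_intros recursive_build decidable_can_fin[where D=D] D) (use I' in simp)
qed

section \<open>Correctness\<close>

definition eq_code :: "('g \<Rightarrow> nat) \<Rightarrow> nat \<times> 'g rhs \<Rightarrow> nat" where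
  "eq_code gc e = pair (fst e) (rhs_code gc (snd e))"

lemma eq_code_simps [simp]:
  "pfst (eq_code gc (v, t)) = v" "psnd (eq_code gc (v, t)) = rhs_code gc t"
  "is_app (eq_code gc (v, Var y)) = False" "target (eq_code gc (v, Var y)) = y"
  by (simp_all add: eq_code_def is_app_def target_def sum_encode_def)

lemma eq_code_App [simp]:
  "is_app (eq_code gc (v, App g zs)) = True" "gen_of (eq_code gc (v, App g zs)) = gc g"
  "list_decode (args_of (eq_code gc (v, App g zs))) = zs"
  by (simp_all add: eq_code_def is_app_def target_def gen_of_def args_of_def sum_encode_def flip: pair_def)

text \<open>\<open>D\<close> and \<open>I\<close> are constrained only on the variables of the
  formula, because the tests read the sort of a variable from the input list.\<close>

locale basic_system =
  fixes \<Sigma> :: "('s, 'g) signature" and gc :: "'g \<Rightarrow> nat" and \<sigma> :: "'s list" and \<alpha> :: "'g basic"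
    and D I :: "nat \<Rightarrow> bool"
  assumes inj: "inj_on gc (gens \<Sigma>)" and basic: "basic_formula \<Sigma> \<sigma> \<alpha>"
    and D: "\<And>x. x < length \<sigma> \<Longrightarrow> D x \<longleftrightarrow> has_finite_tree \<Sigma> (\<sigma> ! x)"
    and I: "\<And>x. x < length \<sigma> \<Longrightarrow> I x \<longleftrightarrow> has_infinite_tree \<Sigma> (\<sigma> ! x)"
begin

abbreviation "eqs \<equiv> set (fst \<alpha>)"
abbreviation "n \<equiv> length \<sigma>"
abbreviation "E \<equiv> eq_code gc ` eqs"
abbreviation "F \<equiv> set (snd \<alpha>)"
abbreviation "eqv_\<alpha> \<equiv> eqv n E"

lemma eqs_Var: "(v, Var y) \<in> eqs \<Longrightarrow> v < n \<and> y < n \<and> \<sigma> ! y = \<sigma> ! v"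
  using basic unfolding basic_formula_def by fastforce

lemma eqs_App: "(v, App g zs) \<in> eqs \<Longrightarrow> v < n \<and> g \<in> gens \<Sigma> \<and> res \<Sigma> g = \<sigma> ! v \<and>
    (\<forall>z\<in>set zs. z < n) \<and> map (\<lambda>z. \<sigma> ! z) zs = args \<Sigma> g"
  using basic unfolding basic_formula_def by fastforce

lemma F_less: "u \<in> F \<Longrightarrow> u < n"
  using basic unfolding basic_formula_def by blast

lemma gen_eq: "(v, App g zs) \<in> eqs \<Longrightarrow> (w, App h ws) \<in> eqs \<Longrightarrow> gc g = gc h \<longleftrightarrow> g = h"
  using eqs_App inj unfolding inj_on_def by blast

lemma is_app_E:
  assumes "e \<in> E" "is_app e"
  obtains v g zs where "(v, App g zs) \<in> eqs" "e = eq_code gc (v, App g zs)"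
proof -
  from assms obtain v t where vt: "(v, t) \<in> eqs" "e = eq_code gc (v, t)" by auto
  then show thesis using assms(2) that by (cases t) auto
qed

lemma not_is_app_E:
  assumes "e \<in> E" "\<not> is_app e"
  obtains v y where "(v, Var y) \<in> eqs" "e = eq_code gc (v, Var y)"
proof -
  from assms obtain v t where vt: "(v, t) \<in> eqs" "e = eq_code gc (v, t)" by auto
  then show thesis using assms(2) that by (cases t) auto
qed

lemma eqv_Var: "(v, Var y) \<in> eqs \<Longrightarrow> eqv_\<alpha> v y"
  using eqv.var[of "eq_code gc (v, Var y)" E n] eqs_Var by auto

lemma same_length:
  assumes "(v, App g zs) \<in> eqs" "(w, App g ws) \<in> eqs"
  shows "length zs = length ws"
  using eqs_App[OF assms(1)] eqs_App[OF assms(2)] by (metis length_map)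

lemma eqv_App:
  assumes "(v, App g zs) \<in> eqs" "(w, App g ws) \<in> eqs" "eqv_\<alpha> v w" "i < length zs"
  shows "eqv_\<alpha> (zs ! i) (ws ! i)"
proof -
  let ?e = "eq_code gc (v, App g zs)" and ?f = "eq_code gc (w, App g ws)"
  have "i < length ws" using assms same_length by metis
  then have *: "zs ! i < n" "ws ! i < n" using assms eqs_App by auto
  have "list_nth (args_of ?e) i = zs ! i" "list_nth (args_of ?f) i = ws ! i"
    "i < list_len (args_of ?e)" "i < list_len (args_of ?f)"
    using assms(4) \<open>i < length ws\<close> by (simp_all add: list_nth_eq list_len_def)
  then show ?thesis
    using eqv.app[of ?e E ?f n i] assms * by auto
qed

text \<open>Induction over the equations themselves instead of their codes; injectivity of
  \<open>gc\<close> on the generators turns equal generator codes into equal generators.\<close>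

lemma eqv_induct [consumes 1, case_names refl sym trans Var App]:
  assumes "eqv_\<alpha> x y" "\<And>x. x < n \<Longrightarrow> P x x" "\<And>x y. P x y \<Longrightarrow> P y x"
    "\<And>x y z. P x y \<Longrightarrow> P y z \<Longrightarrow> P x z" "\<And>v y. (v, Var y) \<in> eqs \<Longrightarrow> P v y"
    "\<And>v w g zs ws i. (v, App g zs) \<in> eqs \<Longrightarrow> (w, App g ws) \<in> eqs \<Longrightarrow> P v w \<Longrightarrow>
       i < length zs \<Longrightarrow> i < length ws \<Longrightarrow> P (zs ! i) (ws ! i)"
  shows "P x y"
  using assms(1)
proof (induction rule: eqv.induct)
  case (var e)
  obtain v y where "(v, Var y) \<in> eqs" "e = eq_code gc (v, Var y)"
    using not_is_app_E[OF var(1,2)] .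
  then show ?case using assms(5) by simp
next
  case (app e f i)
  obtain v g zs where e: "(v, App g zs) \<in> eqs" "e = eq_code gc (v, App g zs)"
    using is_app_E[OF app(1,3)] .
  obtain w h ws where f: "(w, App h ws) \<in> eqs" "f = eq_code gc (w, App h ws)"
    using is_app_E[OF app(2,4)] .
  have "g = h" using app(5) gen_eq[OF e(1) f(1)] e f by simp
  then show ?case
    using app assms(6)[of v g zs w ws i] e f by (simp add: list_nth_eq) (simp add: list_len_def)
qed (use assms(2-4) in blast)+

lemma eqv_same_sort: "eqv_\<alpha> x y \<Longrightarrow> \<sigma> ! x = \<sigma> ! y"
proof (induction rule: eqv_induct)
  case (App v w g zs ws i)
  then show ?case using eqs_App[OF App(1)] eqs_App[OF App(2)] by (metis nth_map)
qed (auto dest: eqs_Var)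

section \<open>Soundness of the closures in the structure of trees\<close>

lemma satisfies_Var: "satisfies \<rho> \<alpha> \<Longrightarrow> (v, Var y) \<in> eqs \<Longrightarrow> \<rho> v = \<rho> y"
  unfolding satisfies_def by fastforce

lemma satisfies_App: "satisfies \<rho> \<alpha> \<Longrightarrow> (v, App g zs) \<in> eqs \<Longrightarrow> \<rho> v = Node g (map \<rho> zs)"
  unfolding satisfies_def by fastforce

text \<open>The congruence rule for arguments is sound because \<open>Node\<close> is
  injective.\<close>

lemma eqv_sound:
  assumes "satisfies \<rho> \<alpha>" "eqv_\<alpha> x y"
  shows "\<rho> x = \<rho> y"
  using assms(2)
proof (induction rule: eqv_induct)
  case (App v w g zs ws i)
  then have "map \<rho> zs = map \<rho> ws" using satisfies_App[OF assms(1)] by (metis tree.inject)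
  then show ?case using App by (metis nth_map)
qed (auto dest: satisfies_Var[OF assms(1)])

lemma bex_is_app_iff: "(\<exists>e\<in>E. is_app e \<and> Q e) \<longleftrightarrow>
    (\<exists>v g zs. (v, App g zs) \<in> eqs \<and> Q (eq_code gc (v, App g zs)))"
  by (metis (no_types, lifting) eq_code_App(1) imageI is_app_E)

lemma sub_iff: "sub n E x y \<longleftrightarrow>
    (\<exists>v g zs z. (v, App g zs) \<in> eqs \<and> eqv_\<alpha> v x \<and> z \<in> set zs \<and> eqv_\<alpha> z y)"
  unfolding sub_def bex_is_app_iff by (simp add: Bex_def)

lemma det_iff: "det n E x \<longleftrightarrow> (\<exists>v g zs. (v, App g zs) \<in> eqs \<and> eqv_\<alpha> v x)"
  unfolding det_def bex_is_app_iff by simp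

lemma sub_sound:
  assumes "satisfies \<rho> \<alpha>" "sub n E x y"
  shows "\<rho> y \<in> set (children (\<rho> x))"
proof -
  obtain v g zs z where *: "(v, App g zs) \<in> eqs" "eqv_\<alpha> v x" "z \<in> set zs" "eqv_\<alpha> z y"
    using assms(2) unfolding sub_iff by blast
  have "\<rho> x = Node g (map \<rho> zs)" "\<rho> z = \<rho> y"
    using eqv_sound[OF assms(1) *(2)] eqv_sound[OF assms(1) *(4)] satisfies_App[OF assms(1) *(1)]
    by simp_all
  then show ?thesis using *(3) by (auto simp flip: \<open>\<rho> z = \<rho> y\<close>)
qed

lemma must_fin_sound:
  assumes "satisfies \<rho> \<alpha>" "must_fin n E F x"
  shows "finite_tree (\<rho> x)"
  using assms(2)
proof (induction rule: must_fin.induct)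
  case (base u x)
  then show ?case using assms(1) eqv_sound[OF assms(1) base(2)] unfolding satisfies_def by auto
next
  case (sub x y)
  then show ?case using sub_sound[OF assms(1) sub(2)] finite_tree_iff by blast
qed

text \<open>Induction on the finite value of \<open>x\<close>: unfolding passes to a child of this
  tree, and the tree itself witnesses that the sort of \<open>x\<close> contains a finite
  one.\<close>

lemma can_fin_complete:
  assumes "satisfies \<rho> \<alpha>" "assignment \<Sigma> \<sigma> \<rho>" "finite_tree (\<rho> x)" "x < n"
  shows "can_fin n E D x"
  using assms(3) assms(3,4)
proof (induction "\<rho> x" arbitrary: x rule: finite_tree_induct)
  case node
  have "D x"
    using node assms(2) D[of x] unfolding has_finite_tree_def assignment_def by blast
  moreover have "can_fin n E D y" if "y < n" "sub n E x y" for y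
    using node that sub_sound[OF assms(1) that(2)] finite_tree_iff by blast
  ultimately show ?case using node.prems by (blast intro: can_fin.intros)
qed

lemma unsatisfiable:
  assumes "clash n E \<or> (\<exists>u\<in>F. \<not> can_fin n E D u)" "assignment \<Sigma> \<sigma> \<rho>"
  shows "\<not> satisfies \<rho> \<alpha>"
proof
  assume sat: "satisfies \<rho> \<alpha>"
  show False
    using assms(1)
  proof
    assume "clash n E"
    then obtain e f where ef: "e \<in> E" "f \<in> E" "is_app e" "is_app f" "eqv_\<alpha> (pfst e) (pfst f)"
      "gen_of e \<noteq> gen_of f" unfolding clash_def by blast
    obtain v g zs where e: "(v, App g zs) \<in> eqs" "e = eq_code gc (v, App g zs)"
      using is_app_E[OF ef(1,3)] .
    obtain w h ws where f: "(w, App h ws) \<in> eqs" "f = eq_code gc (w, App h ws)"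
      using is_app_E[OF ef(2,4)] .
    have "\<rho> v = \<rho> w" using eqv_sound[OF sat ef(5)] e f by simp
    then show False using satisfies_App[OF sat e(1)] satisfies_App[OF sat f(1)] ef(6) e f by simp
  next
    assume "\<exists>u\<in>F. \<not> can_fin n E D u"
    then show False
      using can_fin_complete[OF sat assms(2)] sat F_less unfolding satisfies_def by blast
  qed
qed

section \<open>Class representatives and the solved formula\<close>

abbreviation "r \<equiv> rep n E"

lemma eqv_rep: "x < n \<Longrightarrow> eqv_\<alpha> x (r x)"
  unfolding rep_def by (rule LeastI2_wellorder[of _ x]) (auto intro: eqv.refl)

lemma rep_le: "r x \<le> x"
  unfolding rep_def by (rule Least_le) simp

lemma rep_cong: "eqv_\<alpha> x y \<Longrightarrow> r x = r y"
proof -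
  assume xy: "eqv_\<alpha> x y"
  \<comment> \<open>Below \<open>n\<close> reflexivity absorbs the extra disjunct of
    \<open>rep\<close>, so equivalent variables minimise over the same set.\<close>
  have "eqv_\<alpha> x z \<or> z = x \<longleftrightarrow> eqv_\<alpha> y z \<or> z = y" for z
    using xy by (metis eqv.sym eqv.trans eqv.refl eqv_bounded)
  then show ?thesis unfolding rep_def by simp
qed

lemma rep_rep: "x < n \<Longrightarrow> r (r x) = r x"
  using rep_cong[OF eqv_rep] by simp

lemma det_cong: "eqv_\<alpha> x y \<Longrightarrow> det n E x \<longleftrightarrow> det n E y"
  unfolding det_def by (meson eqv.sym eqv.trans)

lemma must_fin_cong: "must_fin n E F x \<Longrightarrow> eqv_\<alpha> x y \<Longrightarrow> must_fin n E F y"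
proof (induction rule: must_fin.cases)
  case (base u)
  then show ?case by (meson must_fin.base eqv.trans)
next
  case (sub z)
  then have "sub n E z y" unfolding sub_def by (meson eqv.trans)
  then show ?case using sub must_fin.sub by blast
qed

text \<open>The algorithm selects a number, \<open>pick\<close>; this recovers a right-hand side of
  the formula with that code.\<close>

definition def_rhs :: "nat \<Rightarrow> 'g rhs" where
  "def_rhs x = (SOME t. \<exists>v g zs. t = App g zs \<and> (v, t) \<in> eqs \<and> eqv_\<alpha> v x \<and> rhs_code gc t = pick n E x)"

lemma def_rhs:
  assumes "det n E x"
  obtains v g zs where "def_rhs x = App g zs" "(v, App g zs) \<in> eqs" "eqv_\<alpha> v x"
    "rhs_code gc (App g zs) = pick n E x"
proof -
  have "\<exists>e\<in>E. is_app e \<and> eqv_\<alpha> (pfst e) x \<and> psnd e = pick n E x"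
    unfolding pick_def by (rule LeastI2_ex) (use assms in \<open>auto simp: det_def\<close>)
  then have "\<exists>t v g zs. t = App g zs \<and> (v, t) \<in> eqs \<and> eqv_\<alpha> v x \<and> rhs_code gc t = pick n E x"
    by (metis is_app_E eq_code_simps(1,2))
  from someI_ex[OF this] show thesis
    using that unfolding def_rhs_def[symmetric] by metis
qed

text \<open>The formula behind the computed code; the indices are reversed to agree with
  \<open>build\<close>.\<close>

definition solution :: "'g basic" where
  "solution =
    (map (\<lambda>x. (x, if r x \<noteq> x then Var (r x) else def_rhs x)) (filter (\<lambda>x. r x \<noteq> x \<or> det n E x) (rev [0..<n])),
     filter (\<lambda>x. must_fin n E F x \<and> r x = x \<and> \<not> det n E x \<and> I x) (rev [0..<n]))"

lemma solution_Var: "(x, Var y) \<in> set (fst solution) \<longleftrightarrow> x < n \<and> r x \<noteq> x \<and> y = r x"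
  unfolding solution_def by (auto elim!: def_rhs split: if_splits)

lemma solution_App: "(x, App g zs) \<in> set (fst solution) \<longleftrightarrow>
    x < n \<and> r x = x \<and> det n E x \<and> def_rhs x = App g zs"
  unfolding solution_def by (auto split: if_splits)

lemma solution_fin:
  "u \<in> set (snd solution) \<longleftrightarrow> u < n \<and> must_fin n E F u \<and> r u = u \<and> \<not> det n E u \<and> I u"
  unfolding solution_def by auto

lemma solution_code_eq:
  assumes "\<not> (clash n E \<or> (\<exists>u\<in>F. \<not> can_fin n E D u))"
  shows "solution_code D I n E F = output_code gc (Some solution)"
proof -
  have "(case (x, if r x \<noteq> x then Var (r x) else def_rhs x) of (v, t) \<Rightarrow> prod_encode (v, rhs_code gc t))
      = pair x (if r x \<noteq> x then 2 * r x else pick n E x)" if "r x \<noteq> x \<or> det n E x" for x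
  proof (cases "r x = x")
    case True
    then have "det n E x" using that by simp
    then obtain g zs where "def_rhs x = App g zs" "rhs_code gc (App g zs) = pick n E x"
      by (rule def_rhs)
    then show ?thesis using True by (simp add: pair_def)
  qed (simp add: pair_def sum_encode_def)
  then have "map (\<lambda>x. pair x (if r x \<noteq> x then 2 * r x else pick n E x)) (filter (\<lambda>x. r x \<noteq> x \<or> det n E x) (rev [0..<n]))
    = map (\<lambda>(v, t). prod_encode (v, rhs_code gc t)) (fst solution)"
    unfolding solution_def by (simp del: case_prod_conv)
  then show ?thesis
    using assms unfolding solution_code_def build_def output_code_def basic_code_def
    by (simp add: pair_def) (simp add: solution_def)
qed

text \<open>Equivalent variables have the same sort, so an equation may change its left-hand side
  within a class.\<close>

lemma basic_solution: "basic_formula \<Sigma> \<sigma> solution"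
proof -
  have "v < n \<and> (case t of Var y \<Rightarrow> y < n \<and> \<sigma> ! y = \<sigma> ! v
       | App g zs \<Rightarrow> g \<in> gens \<Sigma> \<and> res \<Sigma> g = \<sigma> ! v \<and>
           (\<forall>z\<in>set zs. z < n) \<and> map (\<lambda>z. \<sigma> ! z) zs = args \<Sigma> g)"
    if "(v, t) \<in> set (fst solution)" for v t
  proof (cases t)
    case (Var y)
    then show ?thesis
      using that solution_Var[of v y] eqv_rep[of v] eqv_same_sort[of v y] rep_le[of v] by auto
  next
    case (App g zs)
    then have v: "v < n" "det n E v" "def_rhs v = App g zs" using that solution_App[of v g zs] by auto
    then obtain w where "(w, App g zs) \<in> eqs" "eqv_\<alpha> w v" by (metis def_rhs rhs.inject(2))
    then show ?thesis using App eqs_App[of w g zs] eqv_same_sort[of w v] v by auto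
  qed
  then show ?thesis unfolding basic_formula_def using solution_fin by blast
qed

lemma solved_solution:
  assumes "\<And>u. u \<in> F \<Longrightarrow> can_fin n E D u"
  shows "solved \<Sigma> \<sigma> solution"
proof -
  \<comment> \<open>\<open>can_fin\<close> is invariant under equivalence and passes to unfoldings
    by inversion, so it covers everything that \<open>must_fin\<close> reaches. At a class without
    generator it yields \<open>D\<close>.\<close>
  have fin: "can_fin n E D x" if "must_fin n E F x" for x
    using that
  proof (induction rule: must_fin.induct)
    case (base u x)
    have "sub n E u y" if "sub n E x y" for y
      using that base unfolding sub_def by (meson eqv.sym eqv.trans)
    moreover have "\<sigma> ! u = \<sigma> ! x" using base eqv_same_sort by blast
    ultimately show ?case
      using assms[OF base(1)] base(2) det_cong[OF base(2)] D[of u] D[of x] eqv_bounded[OF base(2)]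
      by (auto elim!: can_fin.cases[of _ _ _ u] intro!: can_fin.intros[of x])
  next
    case (sub x y)
    then show ?case by (metis can_fin.cases must_fin.sub must_fin_bounded)
  qed
  have "has_finite_tree \<Sigma> (\<sigma> ! u) \<and> has_infinite_tree \<Sigma> (\<sigma> ! u)" if "u \<in> set (snd solution)" for u
    using that fin[of u] D[of u] I[of u] unfolding solution_fin by (auto elim: can_fin.cases)
  moreover have "y < x" if "(x, Var y) \<in> set (fst solution)" for x y
    using that rep_le[of x] unfolding solution_Var by simp
  moreover have "distinct (map fst (fst solution) @ snd solution)"
    unfolding solution_def by (auto simp: comp_def)
  ultimately show ?thesis unfolding solved_def by blast
qed

lemma equivalent_solution:
  assumes clash: "\<not> clash n E" and can: "\<And>u. u \<in> F \<Longrightarrow> can_fin n E D u"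
  shows "equivalent \<Sigma> \<sigma> \<alpha> solution"
  unfolding equivalent_def
proof (intro allI impI iffI)
  fix \<rho> assume \<rho>: "assignment \<Sigma> \<sigma> \<rho>"
  {
    assume sat: "satisfies \<rho> \<alpha>"
    have "\<rho> v = eval_rhs \<rho> t" if "(v, t) \<in> set (fst solution)" for v t
    proof (cases t)
      case (Var y)
      then show ?thesis using that solution_Var[of v y] eqv_sound[OF sat eqv_rep] by auto
    next
      case (App g zs)
      then have "det n E v" "def_rhs v = App g zs" using that solution_App[of v g zs] by auto
      then obtain w where w: "(w, App g zs) \<in> eqs" "eqv_\<alpha> w v" by (metis def_rhs rhs.inject(2))
      then show ?thesis using App eqv_sound[OF sat w(2)] satisfies_App[OF sat w(1)] by simp
    qed
    then show "satisfies \<rho> solution"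
      using must_fin_sound[OF sat] solution_fin unfolding satisfies_def by auto
  }
  assume sat: "satisfies \<rho> solution"
  \<comment> \<open>The equations with representatives force one value per class, which gives back
    all consequences of the congruence closure.\<close>
  have rep: "\<rho> x = \<rho> (r x)" if "x < n" for x
  proof (cases "r x = x")
    case False
    then have "(x, Var (r x)) \<in> set (fst solution)" using that solution_Var by simp
    then show ?thesis using sat unfolding satisfies_def by fastforce
  qed simp
  have eqv: "\<rho> x = \<rho> y" if "eqv_\<alpha> x y" for x y
    using rep[of x] rep[of y] rep_cong[OF that] eqv_bounded[OF that] by simp
  \<comment> \<open>Only one generator equation per class was kept. Absence of clashes gives it the
    same generator as the equation for \<open>v\<close>, and congruence gives it equivalent
    arguments.\<close>
  have App: "\<rho> v = Node g (map \<rho> zs)" if vg: "(v, App g zs) \<in> eqs" for v g zs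
  proof -
    have v: "v < n" using eqs_App[OF vg] by simp
    have det: "det n E (r v)" using vg eqv_rep[OF v] det_iff by blast
    then obtain w h ws where w: "def_rhs (r v) = App h ws" "(w, App h ws) \<in> eqs" "eqv_\<alpha> w (r v)"
      by (rule def_rhs)
    have wv: "eqv_\<alpha> v w" using w(3) eqv_rep[OF v] by (meson eqv.sym eqv.trans)
    have "\<not> (gc g \<noteq> gc h)"
    proof
      assume "gc g \<noteq> gc h"
      then have "clash n E"
        unfolding clash_def using vg w(2) wv
        by (intro bexI[of _ "eq_code gc (v, App g zs)"] bexI[of _ "eq_code gc (w, App h ws)"]) auto
      then show False using clash by simp
    qed
    then have h: "h = g" using gen_eq[OF vg w(2)] by simp
    have "(r v, App h ws) \<in> set (fst solution)"
      using w det v rep_rep[OF v] eqv_bounded[OF eqv_rep[OF v]] unfolding solution_App by simp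
    then have "\<rho> (r v) = Node h (map \<rho> ws)" using sat unfolding satisfies_def by fastforce
    moreover have "map \<rho> zs = map \<rho> ws"
      using same_length[OF vg w(2)[unfolded h]] eqv[OF eqv_App[OF vg w(2)[unfolded h] wv]]
      by (auto intro: nth_equalityI)
    ultimately show ?thesis using h rep[OF v] by simp
  qed
  \<comment> \<open>Induction along \<open>can_fin\<close>: a class with generator is finite by its
    arguments, and a class without one either kept its \<open>fin\<close> at the representative or
    has a sort without infinite trees.\<close>
  have fin: "finite_tree (\<rho> x)" if "can_fin n E D x" "must_fin n E F x" for x
    using that
  proof (induction rule: can_fin.induct)
    case (1 x)
    show ?case
    proof (cases "det n E x")
      case True
      then obtain v g zs where v: "(v, App g zs) \<in> eqs" "eqv_\<alpha> v x" unfolding det_iff by blast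
      have "finite_tree (\<rho> z)" if "z \<in> set zs" for z
      proof -
        have z: "z < n" using eqs_App[OF v(1)] that by simp
        then have "sub n E x z" using v that eqv.refl[OF z] unfolding sub_iff by blast
        then show ?thesis using 1 z must_fin.sub by blast
      qed
      then show ?thesis
        using App[OF v(1)] eqv[OF v(2)] finite_tree_iff[of "\<rho> x"] by auto
    next
      case False
      have x: "eqv_\<alpha> x (r x)" "r x < n" using eqv_rep[OF 1(1)] eqv_bounded by blast+
      show ?thesis
      proof (cases "I (r x)")
        case True
        then have "r x \<in> set (snd solution)"
          unfolding solution_fin
          using x False det_cong[OF x(1)] must_fin_cong[OF "1.prems" x(1)] rep_rep[OF 1(1)] by simp
        then show ?thesis using sat rep[OF 1(1)] unfolding satisfies_def by auto
      next
        case False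
        then have "\<not> has_infinite_tree \<Sigma> (\<sigma> ! x)" using I[OF x(2)] eqv_same_sort[OF x(1)] by simp
        then show ?thesis using \<rho> 1(1) unfolding has_infinite_tree_def assignment_def by blast
      qed
    qed
  qed
  have "\<rho> v = eval_rhs \<rho> t" if "(v, t) \<in> eqs" for v t
    using that App eqv[OF eqv_Var] by (cases t) auto
  moreover have "finite_tree (\<rho> u)" if "u \<in> F" for u
    using fin[OF can[OF that]] that must_fin.base eqv.refl[OF F_less[OF that]] by blast
  ultimately show "satisfies \<rho> \<alpha>" unfolding satisfies_def by auto
qed

end

theorem theorem7:
  fixes \<Sigma> :: "('s, 'g) signature" and sc :: "'s \<Rightarrow> nat" and gc :: "'g \<Rightarrow> nat"
  assumes "wf_signature \<Sigma>" and "effective \<Sigma> sc gc"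
  shows "\<exists>A. recursive A \<and>
    (\<forall>n \<sigma> \<alpha>. length \<sigma> = Suc n \<and> set \<sigma> \<subseteq> sorts \<Sigma> \<and> basic_formula \<Sigma> \<sigma> \<alpha> \<longrightarrow>
       (\<exists>\<beta>. A (input_code sc gc \<sigma> \<alpha>) = output_code gc (Some \<beta>) \<and>
          basic_formula \<Sigma> \<sigma> \<beta> \<and> solved \<Sigma> \<sigma> \<beta> \<and> equivalent \<Sigma> \<sigma> \<alpha> \<beta>) \<or>
       (A (input_code sc gc \<sigma> \<alpha>) = output_code gc None \<and>
          \<not> (\<exists>\<beta>. basic_formula \<Sigma> \<sigma> \<beta> \<and> solved \<Sigma> \<sigma> \<beta> \<and> equivalent \<Sigma> \<sigma> \<alpha> \<beta>)))"
proof -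
  obtain d where d: "recursive d" "\<And>s. s \<in> sorts \<Sigma> \<Longrightarrow> d (sc s) = (if has_finite_tree \<Sigma> s then 1 else 0)"
    using assms(2) unfolding effective_def decidable_on_def by auto
  obtain d' where d': "recursive d'" "\<And>s. s \<in> sorts \<Sigma> \<Longrightarrow> d' (sc s) = (if has_infinite_tree \<Sigma> s then 1 else 0)"
    using assms(2) unfolding effective_def decidable_on_def by auto
  \<comment> \<open>Here \<open>l\<close> is the list of sort codes from the input, so entry
    \<open>i\<close> is the code of the sort of variable \<open>i\<close>.\<close>
  define D where "D = (\<lambda>l i. d (list_nth l i) = 1)"
  define I where "I = (\<lambda>l i. d' (list_nth l i) = 1)"
  define A where "A x = solution_code (D (pfst x)) (I (pfst x)) (list_len (pfst x))
    (elems (pfst (psnd x))) (elems (psnd (psnd x)))" for x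
  have "decidable (\<lambda>z. D (pfst z) (psnd z))" "decidable (\<lambda>z. I (pfst z) (psnd z))"
    unfolding D_def I_def
    by (intro rec_intros recursive_comp[OF d(1)] recursive_comp[OF d'(1)])+
  then have "recursive A" unfolding A_def by (rule recursive_solution_code)
  moreover have "(\<exists>\<beta>. A (input_code sc gc \<sigma> \<alpha>) = output_code gc (Some \<beta>) \<and>
        basic_formula \<Sigma> \<sigma> \<beta> \<and> solved \<Sigma> \<sigma> \<beta> \<and> equivalent \<Sigma> \<sigma> \<alpha> \<beta>) \<or>
      (A (input_code sc gc \<sigma> \<alpha>) = output_code gc None \<and>
        \<not> (\<exists>\<beta>. basic_formula \<Sigma> \<sigma> \<beta> \<and> solved \<Sigma> \<sigma> \<beta> \<and> equivalent \<Sigma> \<sigma> \<alpha> \<beta>))"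
    if \<sigma>: "set \<sigma> \<subseteq> sorts \<Sigma>" and basic: "basic_formula \<Sigma> \<sigma> \<alpha>" for \<sigma> \<alpha>
  proof -
    let ?l = "list_encode (map sc \<sigma>)"
    have nth: "list_nth ?l x = sc (\<sigma> ! x)" "\<sigma> ! x \<in> sorts \<Sigma>" if "x < length \<sigma>" for x
      using that \<sigma> by (auto simp: list_nth_eq list_len_def)
    interpret basic_system \<Sigma> gc \<sigma> \<alpha> "D ?l" "I ?l"
      by unfold_locales
        (use assms \<sigma> basic in \<open>auto simp: D_def I_def nth d d' effective_def\<close>)
    have code: "input_code sc gc \<sigma> \<alpha> =
        pair ?l (pair (list_encode (map (eq_code gc) (fst \<alpha>))) (list_encode (snd \<alpha>)))"
      unfolding input_code_def basic_code_def pair_def eq_code_def by (simp add: case_prod_unfold)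
    have A: "A (input_code sc gc \<sigma> \<alpha>) = solution_code (D ?l) (I ?l) n E F"
      unfolding A_def code by (simp add: list_len_def)
    show ?thesis
    proof (cases "clash n E \<or> (\<exists>u\<in>F. \<not> can_fin n E (D ?l) u)")
      case True
      \<comment> \<open>A solved formula holds under some assignment, whereas \<alpha> holds under
        none.\<close>
      have "\<not> (basic_formula \<Sigma> \<sigma> \<beta> \<and> solved \<Sigma> \<sigma> \<beta> \<and> equivalent \<Sigma> \<sigma> \<alpha> \<beta>)" for \<beta>
        using unsatisfiable[OF True] solved_satisfiable[OF assms(1) \<sigma>, of \<beta>]
        unfolding equivalent_def by metis
      then show ?thesis using A True by (simp add: solution_code_def output_code_def)
    next
      case False
      then have "solved \<Sigma> \<sigma> solution" "equivalent \<Sigma> \<sigma> \<alpha> solution"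
        by (auto intro: solved_solution equivalent_solution)
      then show ?thesis using A solution_code_eq[OF False] basic_solution by metis
    qed
  qed
  ultimately show ?thesis by blast
qed

end
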